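(* Let $M$ and $N$ be manifolds-with-boundary with free circle actions near their boundaries, and let $\mathcal{F}_M$ and $\mathcal{F}_N$ be the associated sets of real-valued functions on the cut spaces $M_{\mathrm{cut}}$ and $N_{\mathrm{cut}}$. Let $\psi \colon M\to N$ be an equivariant transverse map, and let $\psi_{\mathrm{cut}} \colon M_{\mathrm{cut}}\to N_{\mathrm{cut}}$ be the induced map. Then for each function $h_N\in\mathcal{F}_N$, the composition $h_M := h_N\circ\psi_{\mathrm{cut}}$ is in $\mathcal{F}_M$.
   Context: Manifolds, with or without boundary, are smooth, Hausdorff and second countable. $S^1=\{a\in\mathbb{C}: |a|=1\}$. For a manifold-with-boundary $M$, $\mathring{M}$ denotes the interior and $\partial M$ the boundary. "A free circle action near the boundary" means a smooth free action of $S^1$ on an open neighbourhood $U_M$ of $\partial M$ in $M$; necessarily $\partial M$ is $S^1$-invariant. Cut space: let $\sim$ be the equivalence relation on $M$ in which distinct points are equivalent iff they both lie in $\partial M$ and lie in the same $S^1$-orbit. $M_{\mathrm{cut}} := M/{\sim}$ with the quotient topology; $c_M \colon M \to M_{\mathrm{cut}}$ is the quotient map. An invariant boundary defining function on $M$ is a smooth $f \colon M \to \mathbb{R}_{\ge 0}$ such that $f^{-1}(0)=\partial M$, $df|_{\partial M}$ never vanishes, and $f$ is $S^1$-invariant on some $S^1$-invariant neighbourhood of $\partial M$ in $U_M$. Fix an invariant boundary defining function $f$ on $M$. $\mathcal{F}_M$ is the set of functions $h \colon M_{\mathrm{cut}}\to\mathbb{R}$ such that $\widehat{h} := h\circ c_M$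 satisfies: ($\mathcal{F}1$) $\widehat{h}|_{\mathring{M}}$ is smooth; ($\mathcal{F}2$) there exist an $S^1$-invariant open neighbourhood $V$ of $\partial M$ in $U_M$ and a smooth function $H \colon V\times\mathbb{C}\to\mathbb{R}$ such that (a) $H(a\cdot x,z)=H(x,az)$ for all $a\in S^1$, $(x,z)\in V\times\mathbb{C}$, and (b) $\widehat{h}(x)=H(x,\sqrt{f(x)})$ for all $x\in V$. $\mathcal{F}_M$ does not depend on the choice of $f$. A map $\psi \colon M\to N$ is an equivariant transverse map if: $\psi$ is smooth; for some (hence every) invariant boundary defining function $f_N$ on $N$, the composition $f_N\circ\psi$ is an invariant boundary defining function on $M$; and there is an $S^1$-invariant neighbourhood $V$ of $\partial M$ in $M$, contained in $U_M\cap\psi^{-1}(U_N)$, such that $\psi|_V \colon V\to U_N$ is $S^1$-equivariant. $\psi_{\mathrm{cut}}$ is the unique map with $\psi_{\mathrm{cut}}\circ c_M=c_N\circ\psi$. *)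

theory Defs
  imports "HOL-Analysis.Analysis"
begin

section \<open>Smooth maps between subsets of vector spaces\<close>

text \<open>On an open set \<open>S\<close> of a finite-dimensional space, \<open>Ck_on k f S\<close> says that \<open>f\<close> is of class
  \<open>C^k\<close>: all iterated directional derivatives of order less than \<open>k\<close> are differentiable, and those
  of order at most \<open>k\<close> are continuous.\<close>

primrec Ck_on ::
  "nat \<Rightarrow> ('e::real_normed_vector \<Rightarrow> 'f::real_normed_vector) \<Rightarrow> 'e set \<Rightarrow> bool" where
  "Ck_on 0 f S \<longleftrightarrow> continuous_on S f"
| "Ck_on (Suc k) f S \<longleftrightarrow>
     (\<forall>x\<in>S. f differentiable (at x)) \<and>
     (\<forall>v. Ck_on k (\<lambda>x. frechet_derivative f (at x) v) S)"

text \<open>A function on an arbitrary subset \<open>A\<close> is smooth if near each point of \<open>A\<close> it is the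
  restriction of a smooth function on an open set of the ambient space.\<close>

definition smooth_on ::
  "'e::real_normed_vector set \<Rightarrow> ('e \<Rightarrow> 'f::real_normed_vector) \<Rightarrow> bool" where
  "smooth_on A f \<longleftrightarrow>
     (\<forall>x\<in>A. \<exists>T g. open T \<and> x \<in> T \<and> (\<forall>k. Ck_on k g T) \<and> (\<forall>y\<in>A \<inter> T. g y = f y))"


section \<open>Manifolds with boundary\<close>

text \<open>A chart is a pair of its domain and the coordinate map; values of the coordinate map outside
  the domain are irrelevant. The smooth structure is the one generated by the given (not necessarily
  maximal) atlas.\<close>

record ('a, 'e) bmanifold =
  mtop :: "'a topology"
  charts :: "('a set \<times> ('a \<Rightarrow> 'e)) set"

text \<open>For \<open>b \<noteq> 0\<close> this is a closed half-space; \<open>b = 0\<close> gives the whole space.\<close>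

definition halfspace :: "'e::real_inner \<Rightarrow> 'e set" where
  "halfspace b = {x. 0 \<le> b \<bullet> x}"

text \<open>The model space is an arbitrary finite-dimensional real inner product space. It is not
  required to be of class \<open>euclidean_space\<close>, since that class excludes dimension zero.\<close>

definition is_bmanifold :: "('a, 'e::real_inner, 'm) bmanifold_scheme \<Rightarrow> bool" where
  "is_bmanifold M \<longleftrightarrow>
     (\<exists>B::'e set. finite B \<and> span B = UNIV) \<and>
     Hausdorff_space (mtop M) \<and> second_countable (mtop M) \<and>
     (\<Union>(U, \<phi>)\<in>charts M. U) = topspace (mtop M) \<and>
     (\<forall>(U, \<phi>)\<in>charts M.
        openin (mtop M) U \<and>
        (\<exists>b. openin (top_of_set (halfspace b)) (\<phi> ` U)) \<and>
        homeomorphic_map (subtopology (mtop M) U) (top_of_set (\<phi> ` U)) \<phi>) \<and>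
     (\<forall>(U, \<phi>)\<in>charts M. \<forall>(V, \<eta>)\<in>charts M.
        smooth_on (\<phi> ` (U \<inter> V)) (\<eta> \<circ> inv_into U \<phi>))"

definition mboundary :: "('a, 'e::real_inner, 'm) bmanifold_scheme \<Rightarrow> 'a set" where
  "mboundary M =
     {p. \<exists>(U, \<phi>)\<in>charts M. p \<in> U \<and>
         (\<exists>b. b \<noteq> 0 \<and> openin (top_of_set (halfspace b)) (\<phi> ` U) \<and> b \<bullet> \<phi> p = 0)}"

definition minterior :: "('a, 'e::real_inner, 'm) bmanifold_scheme \<Rightarrow> 'a set" where
  "minterior M = topspace (mtop M) - mboundary M"

definition smooth_map ::
  "('a, 'e::real_inner, 'm) bmanifold_scheme \<Rightarrow> ('b, 'f::real_inner, 'n) bmanifold_scheme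
    \<Rightarrow> ('a \<Rightarrow> 'b) \<Rightarrow> bool" where
  "smooth_map M N F \<longleftrightarrow>
     continuous_map (mtop M) (mtop N) F \<and>
     (\<forall>(U, \<phi>)\<in>charts M. \<forall>(V, \<eta>)\<in>charts N.
        smooth_on (\<phi> ` (U \<inter> F -` V)) (\<eta> \<circ> F \<circ> inv_into U \<phi>))"

definition open_submanifold ::
  "('a, 'e, 'm) bmanifold_scheme \<Rightarrow> 'a set \<Rightarrow> ('a, 'e) bmanifold" where
  "open_submanifold M W =
     \<lparr>mtop = subtopology (mtop M) W, charts = (\<lambda>(U, \<phi>). (U \<inter> W, \<phi>)) ` charts M\<rparr>"

text \<open>The product is a manifold with boundary provided that one of the factors has empty boundary.\<close>

definition prod_manifold ::
  "('a, 'e, 'm) bmanifold_scheme \<Rightarrow> ('b, 'f, 'n) bmanifold_scheme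
    \<Rightarrow> ('a \<times> 'b, 'e \<times> 'f) bmanifold" where
  "prod_manifold M N =
     \<lparr>mtop = prod_topology (mtop M) (mtop N),
      charts = {(U \<times> V, map_prod \<phi> \<eta>) | U \<phi> V \<eta>. (U, \<phi>) \<in> charts M \<and> (V, \<eta>) \<in> charts N}\<rparr>"

definition vector_space_manifold :: "('v::real_inner, 'v) bmanifold" where
  "vector_space_manifold = \<lparr>mtop = euclidean, charts = {(UNIV, id)}\<rparr>"

definition S1 :: "complex set" where
  "S1 = {a. cmod a = 1}"

text \<open>The charts of the circle are the branches of the argument.\<close>

definition circle_manifold :: "(complex, real) bmanifold" where
  "circle_manifold =
     \<lparr>mtop = top_of_set S1,
      charts = {(cis ` {t<..<t + 2 * pi}, inv_into {t<..<t + 2 * pi} cis) | t. True}\<rparr>"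

abbreviation smooth_real_function ::
  "('a, 'e::real_inner, 'm) bmanifold_scheme \<Rightarrow> ('a \<Rightarrow> real) \<Rightarrow> bool" where
  "smooth_real_function M \<equiv> smooth_map M vector_space_manifold"

text \<open>The derivative is taken within the image of the chart, which is relatively open in a
  half-space, so that it is unique also at boundary points.\<close>

definition differential_vanishes_at ::
  "('a, 'e::real_inner, 'm) bmanifold_scheme \<Rightarrow> ('a \<Rightarrow> real) \<Rightarrow> 'a \<Rightarrow> bool" where
  "differential_vanishes_at M f p \<longleftrightarrow>
     (\<exists>(U, \<phi>)\<in>charts M. p \<in> U \<and>
        ((f \<circ> inv_into U \<phi>) has_derivative (\<lambda>v. 0)) (at (\<phi> p) within \<phi> ` U))"


section \<open>Free circle actions near the boundary\<close>

text \<open>The action \<open>act\<close> is only meaningful for elements of \<open>S1\<close> and points of \<open>act_dom\<close>, the open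
  neighbourhood of the boundary on which the circle acts.\<close>

record ('a, 'e) circle_bmanifold = "('a, 'e) bmanifold" +
  act_dom :: "'a set"
  act :: "complex \<Rightarrow> 'a \<Rightarrow> 'a"

definition free_circle_action_near_boundary ::
  "('a, 'e::real_inner, 'm) circle_bmanifold_scheme \<Rightarrow> bool" where
  "free_circle_action_near_boundary M \<longleftrightarrow>
     is_bmanifold M \<and>
     openin (mtop M) (act_dom M) \<and> mboundary M \<subseteq> act_dom M \<and>
     (\<forall>a\<in>S1. \<forall>x\<in>act_dom M. act M a x \<in> act_dom M) \<and>
     (\<forall>x\<in>act_dom M. act M 1 x = x) \<and>
     (\<forall>a\<in>S1. \<forall>b\<in>S1. \<forall>x\<in>act_dom M. act M (a * b) x = act M a (act M b x)) \<and>
     smooth_map (prod_manifold circle_manifold (open_submanifold M (act_dom M)))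
       (open_submanifold M (act_dom M)) (\<lambda>(a, x). act M a x) \<and>
     (\<forall>a\<in>S1. \<forall>x\<in>act_dom M. act M a x = x \<longrightarrow> a = 1)"

text \<open>Neighbourhoods are not required to be open.\<close>

definition invariant_boundary_nbhd ::
  "('a, 'e::real_inner, 'm) circle_bmanifold_scheme \<Rightarrow> 'a set \<Rightarrow> bool" where
  "invariant_boundary_nbhd M V \<longleftrightarrow>
     V \<subseteq> act_dom M \<and>
     (\<exists>W. openin (mtop M) W \<and> mboundary M \<subseteq> W \<and> W \<subseteq> V) \<and>
     (\<forall>a\<in>S1. \<forall>x\<in>V. act M a x \<in> V)"

definition invariant_boundary_defining_function ::
  "('a, 'e::real_inner, 'm) circle_bmanifold_scheme \<Rightarrow> ('a \<Rightarrow> real) \<Rightarrow> bool" where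
  "invariant_boundary_defining_function M f \<longleftrightarrow>
     smooth_real_function M f \<and>
     (\<forall>x\<in>topspace (mtop M). 0 \<le> f x) \<and>
     {x \<in> topspace (mtop M). f x = 0} = mboundary M \<and>
     (\<forall>p\<in>mboundary M. \<not> differential_vanishes_at M f p) \<and>
     (\<exists>V. invariant_boundary_nbhd M V \<and> (\<forall>a\<in>S1. \<forall>x\<in>V. f (act M a x) = f x))"


section \<open>The cut space and its functions\<close>

definition cut_rel :: "('a, 'e::real_inner, 'm) circle_bmanifold_scheme \<Rightarrow> 'a rel" where
  "cut_rel M =
     {(x, y). x \<in> topspace (mtop M) \<and> y \<in> topspace (mtop M) \<and>
        (x = y \<or> x \<in> mboundary M \<and> y \<in> mboundary M \<and> (\<exists>a\<in>S1. y = act M a x))}"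

definition cut_proj ::
  "('a, 'e::real_inner, 'm) circle_bmanifold_scheme \<Rightarrow> 'a \<Rightarrow> 'a set" where
  "cut_proj M x = cut_rel M `` {x}"

definition cut_space ::
  "('a, 'e::real_inner, 'm) circle_bmanifold_scheme \<Rightarrow> 'a set topology" where
  "cut_space M =
     topology (\<lambda>W. W \<subseteq> topspace (mtop M) // cut_rel M \<and>
                   openin (mtop M) {x \<in> topspace (mtop M). cut_proj M x \<in> W})"

lemma openin_cut_space:
  "openin (cut_space M) W \<longleftrightarrow>
     W \<subseteq> topspace (mtop M) // cut_rel M \<and>
     openin (mtop M) {x \<in> topspace (mtop M). cut_proj M x \<in> W}"
proof -
  have Int: "{x \<in> topspace (mtop M). cut_proj M x \<in> S \<inter> T} =
      {x \<in> topspace (mtop M). cut_proj M x \<in> S} \<inter> {x \<in> topspace (mtop M). cut_proj M x \<in> T}"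
    for S T by auto
  have Un: "{x \<in> topspace (mtop M). cut_proj M x \<in> \<Union>K} =
      \<Union>((\<lambda>S. {x \<in> topspace (mtop M). cut_proj M x \<in> S}) ` K)" for K
    by auto
  have "istopology (\<lambda>W. W \<subseteq> topspace (mtop M) // cut_rel M \<and>
      openin (mtop M) {x \<in> topspace (mtop M). cut_proj M x \<in> W})"
    unfolding istopology_def Int Un by (blast intro: openin_Int openin_Union)
  then show ?thesis
    unfolding cut_space_def by (simp add: topology_inverse')
qed

lemma topspace_cut_space: "topspace (cut_space M) = topspace (mtop M) // cut_rel M"
proof -
  have "{x \<in> topspace (mtop M). cut_proj M x \<in> topspace (mtop M) // cut_rel M} =
      topspace (mtop M)"
    by (auto simp: cut_proj_def quotientI)
  then have "openin (cut_space M) (topspace (mtop M) // cut_rel M)"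
    by (simp add: openin_cut_space)
  then show ?thesis
    by (meson openin_cut_space openin_subset openin_topspace subset_antisym)
qed

lemma quotient_map_cut_proj: "quotient_map (mtop M) (cut_space M) (cut_proj M)"
  unfolding quotient_map_def
  by (auto simp: topspace_cut_space openin_cut_space cut_proj_def quotient_def)

text \<open>The set of functions on the cut space determined by an invariant boundary defining
  function \<open>f\<close>.\<close>

definition cut_functions ::
  "('a, 'e::real_inner, 'm) circle_bmanifold_scheme \<Rightarrow> ('a \<Rightarrow> real) \<Rightarrow> ('a set \<Rightarrow> real) set" where
  "cut_functions M f =
     {h \<in> extensional (topspace (cut_space M)).
        smooth_real_function (open_submanifold M (minterior M)) (h \<circ> cut_proj M) \<and>
        (\<exists>V H. openin (mtop M) V \<and> invariant_boundary_nbhd M V \<and>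
           smooth_real_function
             (prod_manifold (open_submanifold M V) (vector_space_manifold :: (complex, complex) bmanifold))
             H \<and>
           (\<forall>a\<in>S1. \<forall>x\<in>V. \<forall>z. H (act M a x, z) = H (x, a * z)) \<and>
           (\<forall>x\<in>V. (h \<circ> cut_proj M) x = H (x, complex_of_real (sqrt (f x)))))}"


section \<open>Equivariant transverse maps\<close>

definition equivariant_transverse_map ::
  "('a, 'e::real_inner, 'm) circle_bmanifold_scheme
    \<Rightarrow> ('b, 'f::real_inner, 'n) circle_bmanifold_scheme \<Rightarrow> ('a \<Rightarrow> 'b) \<Rightarrow> bool" where
  "equivariant_transverse_map M N \<psi> \<longleftrightarrow>
     smooth_map M N \<psi> \<and>
     (\<exists>f. invariant_boundary_defining_function N f \<and>
          invariant_boundary_defining_function M (f \<circ> \<psi>)) \<and>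
     (\<exists>V. invariant_boundary_nbhd M V \<and> V \<subseteq> \<psi> -` act_dom N \<and>
          (\<forall>a\<in>S1. \<forall>x\<in>V. \<psi> (act M a x) = act N a (\<psi> x)))"

definition cut_map ::
  "('a, 'e::real_inner, 'm) circle_bmanifold_scheme
    \<Rightarrow> ('b, 'f::real_inner, 'n) circle_bmanifold_scheme \<Rightarrow> ('a \<Rightarrow> 'b) \<Rightarrow> 'a set \<Rightarrow> 'b set" where
  "cut_map M N \<psi> =
     (THE g. g \<in> topspace (cut_space M) \<rightarrow>\<^sub>E topspace (cut_space N) \<and>
             (\<forall>x\<in>topspace (mtop M). g (cut_proj M x) = cut_proj N (\<psi> x)))"

end

theory Submission
  imports Defs
begin

text \<open>
  If \<open>g = (f\<^sub>N \<circ> \<psi>) / f\<^sub>M\<close> extends to a smooth positive invariant function near the boundary of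
  \<open>M\<close>, and \<open>H\<^sub>N\<close> witnesses \<open>h\<^sub>N \<in> \<F>\<^sub>N\<close>, then \<open>H (x, z) = H\<^sub>N (\<psi> x, sqrt (g x) z)\<close> witnesses
  \<open>h\<^sub>N \<circ> \<psi>\<^sub>c\<^sub>u\<^sub>t \<in> \<F>\<^sub>M\<close>. Transversality is given for some boundary defining function \<open>f\<close> on \<open>N\<close>
  only, so \<open>g\<close> is written as \<open>((f\<^sub>N / f) \<circ> \<psi>) \<cdot> ((f \<circ> \<psi>) / f\<^sub>M)\<close>. In a boundary chart every
  boundary defining function is the distance to the boundary hyperplane times a positive smooth
  function (Hadamard's lemma), hence quotients of boundary defining functions are smooth and
  positive up to the boundary. Invariance of \<open>g\<close> holds in the interior and extends to the
  boundary by density.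
\<close>

section \<open>Calculus of \<open>C^k\<close> functions\<close>

text \<open>The factor \<open>sqrt (g x)\<close> is what turns \<open>sqrt (f\<^sub>M x)\<close>
  into \<open>sqrt (f\<^sub>N (\<psi> x))\<close>. Being a real scalar it commutes with the rotation
  of \<open>z\<close>, so equivariance of the new function only needs invariance of
  \<open>g\<close>. It is smooth only because \<open>g\<close> stays positive on the boundary; this
  is where the nonvanishing differentials enter, since they make boundary defining functions vanish
  to exactly first order. The obstacle is that \<open>g\<close> has the form 0/0 on the boundary.
  Its values there come from local quotients in charts; these need no partition of unity to be
  glued, because continuity and density of the interior determine them. A second obstacle is that
  chart images at boundary points are not open. Smoothness there means that a smooth local extension
  exists, about which nothing is known beyond the half-space. Hadamard's lemma is applied to such an
  extension, and signs are tested only on the half-space side. The model spaces form no class with a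
  fixed basis, so the calculus expands vectors along a finite orthogonal set.\<close>

lemma Ck_on_cong:
  assumes "open S" "Ck_on k f S" "\<And>x. x \<in> S \<Longrightarrow> f x = g x"
  shows "Ck_on k g S"
  using assms
proof (induction k arbitrary: f g)
  case 0
  then show ?case by (simp cong: continuous_on_cong)
next
  case (Suc k)
  have der: "(g has_derivative D) (at x)" if "x \<in> S" "(f has_derivative D) (at x)" for x D
    using that Suc.prems by (metis has_derivative_transform_within_open)
  have "frechet_derivative g (at x) = frechet_derivative f (at x)" if "x \<in> S" for x
    using der[OF that] Suc.prems(2) that
    by (metis Ck_on.simps(2) frechet_derivative_at frechet_derivative_works)
  moreover have "g differentiable at x" if "x \<in> S" for x
    using der[OF that] Suc.prems(2) that unfolding Ck_on.simps differentiable_def by blast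
  moreover have "Ck_on k (\<lambda>x. frechet_derivative g (at x) v) S" for v
    by (rule Suc.IH[OF \<open>open S\<close>, of "\<lambda>x. frechet_derivative f (at x) v"])
      (use Suc.prems(2) calculation(1) in simp_all)
  ultimately show ?case by simp
qed

text \<open>Derivatives are unique on an open set, so any explicitly computed family
  \<open>D\<close> may stand in for the chosen \<open>frechet_derivative\<close>. All closure
  properties below are inductions through this rule.\<close>

lemma Ck_on_SucI:
  assumes "open S" "\<And>x. x \<in> S \<Longrightarrow> (f has_derivative D x) (at x)"
    and "\<And>v. Ck_on k (\<lambda>x. D x v) S"
  shows "Ck_on (Suc k) f S"
proof -
  have "D x = frechet_derivative f (at x)" if "x \<in> S" for x
    using assms(2)[OF that] by (rule frechet_derivative_at)
  then have "Ck_on k (\<lambda>x. frechet_derivative f (at x) v) S" for v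
    by (intro Ck_on_cong[OF assms(1) assms(3)[of v]]) auto
  with assms(2) show ?thesis by (auto simp: differentiable_def)
qed

lemma Ck_on_Suc_has_derivative:
  assumes "Ck_on (Suc k) f S" "x \<in> S"
  shows "(f has_derivative frechet_derivative f (at x)) (at x)"
  using assms by (simp add: frechet_derivative_works)

lemma Ck_on_subset: "Ck_on k f S \<Longrightarrow> T \<subseteq> S \<Longrightarrow> Ck_on k f T"
  by (induction k arbitrary: f) (auto intro: continuous_on_subset)

lemma Ck_on_SucD: "Ck_on (Suc k) f S \<Longrightarrow> Ck_on k f S"
proof (induction k arbitrary: f)
  case 0
  then show ?case
    by (auto simp: continuous_on_eq_continuous_within
        intro!: differentiable_imp_continuous_within intro: differentiable_at_withinI)
next
  case (Suc k)
  have "Ck_on k (\<lambda>x. frechet_derivative f (at x) v) S" for v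
    using Suc.prems by (intro Suc.IH) (simp only: Ck_on.simps(2)[of "Suc k"])
  with Suc.prems show ?case by simp
qed

lemma Ck_on_mono: "Ck_on k f S \<Longrightarrow> j \<le> k \<Longrightarrow> Ck_on j f S"
proof (induction k)
  case (Suc k)
  then show ?case using Ck_on_SucD by (metis le_Suc_eq)
qed simp

lemma Ck_on_imp_continuous_on: "Ck_on k f S \<Longrightarrow> continuous_on S f"
  by (induction k) (auto dest: Ck_on_SucD simp del: Ck_on.simps(2))

lemma Ck_on_const: "open S \<Longrightarrow> Ck_on k (\<lambda>x. c) S"
proof (induction k arbitrary: c)
  case (Suc k)
  show ?case
    by (rule Ck_on_SucI[OF Suc.prems has_derivative_const]) (rule Suc.IH[OF Suc.prems])
qed simp

lemma Ck_on_bounded_linear: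
  assumes "bounded_linear L" "open S"
  shows "Ck_on k L S"
proof (cases k)
  case 0
  then show ?thesis using assms by (simp add: linear_continuous_on)
next
  case (Suc k')
  show ?thesis unfolding Suc
    by (rule Ck_on_SucI[OF assms(2) bounded_linear_imp_has_derivative[OF assms(1)]])
      (rule Ck_on_const[OF assms(2)])
qed

lemma Ck_on_bounded_linear_compose:
  assumes L: "bounded_linear L" and S: "open S" and "Ck_on k f S"
  shows "Ck_on k (\<lambda>x. L (f x)) S"
  using assms(3)
proof (induction k arbitrary: f)
  case 0
  then show ?case using L by (simp add: bounded_linear.continuous_on)
next
  case (Suc k)
  show ?case
  proof (rule Ck_on_SucI[OF S])
    show "((\<lambda>x. L (f x)) has_derivative (\<lambda>v. L (frechet_derivative f (at x) v))) (at x)"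
      if "x \<in> S" for x
      using Ck_on_Suc_has_derivative[OF Suc.prems that] by (rule bounded_linear.has_derivative[OF L])
    show "Ck_on k (\<lambda>x. L (frechet_derivative f (at x) v)) S" for v
      using Suc.prems by (intro Suc.IH) simp
  qed
qed

lemma Ck_on_add:
  assumes S: "open S" and "Ck_on k f S" "Ck_on k g S"
  shows "Ck_on k (\<lambda>x. f x + g x) S"
  using assms(2,3)
proof (induction k arbitrary: f g)
  case 0
  then show ?case by (simp add: continuous_on_add)
next
  case (Suc k)
  show ?case
  proof (rule Ck_on_SucI[OF S])
    show "((\<lambda>x. f x + g x) has_derivative
        (\<lambda>v. frechet_derivative f (at x) v + frechet_derivative g (at x) v)) (at x)"
      if "x \<in> S" for x
      using Suc.prems[THEN Ck_on_Suc_has_derivative, OF that] by (rule has_derivative_add)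
    show "Ck_on k (\<lambda>x. frechet_derivative f (at x) v + frechet_derivative g (at x) v) S" for v
      using Suc.prems by (intro Suc.IH) simp_all
  qed
qed

lemma Ck_on_sum:
  assumes "open S" "\<And>i. i \<in> I \<Longrightarrow> Ck_on k (f i) S"
  shows "Ck_on k (\<lambda>x. \<Sum>i\<in>I. f i x) S"
  using assms(2)
  by (induction I rule: infinite_finite_induct) (simp_all add: Ck_on_const Ck_on_add assms(1))

lemma Ck_on_bilinear:
  assumes B: "bounded_bilinear B" and S: "open S" and "Ck_on k f S" "Ck_on k g S"
  shows "Ck_on k (\<lambda>x. B (f x) (g x)) S"
  using assms(3,4)
proof (induction k arbitrary: f g)
  case 0
  then show ?case by (simp add: bounded_bilinear.continuous_on[OF B])
next
  case (Suc k)
  show ?case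
  proof (rule Ck_on_SucI[OF S])
    show "((\<lambda>x. B (f x) (g x)) has_derivative
        (\<lambda>v. B (f x) (frechet_derivative g (at x) v) + B (frechet_derivative f (at x) v) (g x)))
        (at x)" if "x \<in> S" for x
      using Suc.prems[THEN Ck_on_Suc_has_derivative, OF that] by (rule bounded_bilinear.FDERIV[OF B])
    show "Ck_on k (\<lambda>x. B (f x) (frechet_derivative g (at x) v)
        + B (frechet_derivative f (at x) v) (g x)) S" for v
      using Suc.prems Suc.prems[THEN Ck_on_SucD] by (intro Ck_on_add[OF S] Suc.IH) simp_all
  qed
qed

lemma Ck_on_Pair:
  assumes S: "open S" and "Ck_on k f S" "Ck_on k g S"
  shows "Ck_on k (\<lambda>x. (f x, g x)) S"
proof -
  have "bounded_linear (\<lambda>x. (x, 0))" "bounded_linear (\<lambda>x. (0, x))"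
    by (auto intro!: bounded_linear_Pair bounded_linear_ident bounded_linear_zero)
  then have "Ck_on k (\<lambda>x. (f x, 0) + (0, g x)) S"
    using assms by (intro Ck_on_add Ck_on_bounded_linear_compose[of "\<lambda>x. (x, 0)"]
        Ck_on_bounded_linear_compose[of "\<lambda>x. (0, x)"])
  then show ?thesis by simp
qed

text \<open>Orthogonalising a finite spanning set replaces the missing fixed basis. The vectors are
  not normalised, hence the divisor \<open>c \<bullet> c\<close>; \<open>C\<close> is empty in
  dimension zero.\<close>

lemma finite_dim_expansion:
  assumes "finite (B::'a::real_inner set)" "span B = UNIV"
  obtains C where "finite C" "0 \<notin> C" "\<And>x::'a. x = (\<Sum>c\<in>C. (x \<bullet> c / (c \<bullet> c)) *\<^sub>R c)"
proof -
  obtain C0 :: "'a set" where C0: "finite C0" "span C0 = UNIV" "pairwise orthogonal C0"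
    using basis_orthogonal[OF assms(1)] assms(2) by auto
  define C where "C = C0 - {0}"
  have C: "finite C" "span C = UNIV" "pairwise orthogonal C" "0 \<notin> C"
    using C0 by (auto simp: C_def pairwise_def)
  have "x = (\<Sum>c\<in>C. (x \<bullet> c / (c \<bullet> c)) *\<^sub>R c)" for x
  proof -
    \<comment> \<open>The residual is orthogonal to the spanning set \<open>C\<close>, hence to
      itself, hence zero.\<close>
    let ?y = "x - (\<Sum>c\<in>C. (x \<bullet> c / (c \<bullet> c)) *\<^sub>R c)"
    have "orthogonal ?y c" if "c \<in> C" for c
    proof -
      have "(\<Sum>d\<in>C. (x \<bullet> d / (d \<bullet> d)) *\<^sub>R d) \<bullet> c = (\<Sum>d\<in>C. if d = c then x \<bullet> c else 0)"
        unfolding inner_sum_left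
        using C(3,4) that by (intro sum.cong) (auto simp: pairwise_def orthogonal_def)
      then show ?thesis
        using C(1) that by (simp add: orthogonal_def inner_diff_left)
    qed
    then have "orthogonal ?y ?y"
      using C(2) orthogonal_to_span[of ?y C ?y] by (simp add: orthogonal_commute)
    then show ?thesis by (simp add: orthogonal_self)
  qed
  with C that show thesis by blast
qed

lemma bounded_linear_expansion:
  assumes "\<And>x::'a::real_inner. x = (\<Sum>c\<in>C. (x \<bullet> c / (c \<bullet> c)) *\<^sub>R c)" and "bounded_linear L"
  shows "L u = (\<Sum>c\<in>C. (u \<bullet> c / (c \<bullet> c)) *\<^sub>R L c)"
proof -
  interpret bounded_linear L by fact
  show ?thesis by (subst assms(1)[of u]) (simp add: sum scaleR)
qed

text \<open>The chain rule differentiates \<open>g\<close> in the direction \<open>Df(x) v\<close>,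
  which moves with \<open>x\<close>, while \<open>Ck_on\<close> controls only fixed directions.
  Expanding that vector along a finite set \<open>C\<close> of the middle space gives a finite sum
  of products, to which the induction hypothesis applies with \<open>g\<close> replaced by its
  derivative in each direction \<open>c\<close>.\<close>

lemma Ck_on_compose:
  fixes f :: "'a::real_normed_vector \<Rightarrow> 'b::real_inner" and g :: "'b \<Rightarrow> 'c::real_normed_vector"
  assumes fin: "finite (B::'b set)" "span B = UNIV"
    and S: "open S" and "Ck_on k f S" "Ck_on k g T" "f ` S \<subseteq> T"
  shows "Ck_on k (\<lambda>x. g (f x)) S"
  using assms(4-6)
proof (induction k arbitrary: f g)
  case 0
  then show ?case using continuous_on_compose2 by auto
next
  case (Suc k)
  obtain C where C: "finite C" "\<And>x::'b. x = (\<Sum>c\<in>C. (x \<bullet> c / (c \<bullet> c)) *\<^sub>R c)"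
    using finite_dim_expansion[OF fin] by metis
  have bl: "bounded_linear (\<lambda>x::'b. x \<bullet> c / (c \<bullet> c))" for c
    by (intro bounded_linear_compose[OF bounded_linear_divide bounded_linear_inner_left])
  note eq = bounded_linear_expansion[OF C(2)]
  show ?case
  proof (rule Ck_on_SucI[OF S])
    fix x assume x: "x \<in> S"
    then have fx: "f x \<in> T" using Suc.prems by auto
    note der = Ck_on_Suc_has_derivative[OF Suc.prems(1) x] Ck_on_Suc_has_derivative[OF Suc.prems(2) fx]
    have "((\<lambda>x. g (f x)) has_derivative
       (\<lambda>v. frechet_derivative g (at (f x)) (frechet_derivative f (at x) v))) (at x)"
      using der by (rule has_derivative_compose)
    then show "((\<lambda>x. g (f x)) has_derivative (\<lambda>v. \<Sum>c\<in>C.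
        (frechet_derivative f (at x) v \<bullet> c / (c \<bullet> c)) *\<^sub>R frechet_derivative g (at (f x)) c)) (at x)"
      unfolding eq[OF has_derivative_bounded_linear[OF der(2)], symmetric] .
  next
    fix v
    have "Ck_on k (\<lambda>x. frechet_derivative f (at x) v) S" using Suc.prems(1) by simp
    then have "Ck_on k (\<lambda>x. frechet_derivative f (at x) v \<bullet> c / (c \<bullet> c)) S" for c
      by (rule Ck_on_bounded_linear_compose[OF bl S])
    moreover have "Ck_on k (\<lambda>x. frechet_derivative g (at (f x)) c) S" for c
      using Suc.prems(2,3) Ck_on_SucD[OF Suc.prems(1)] by (intro Suc.IH) simp_all
    ultimately show "Ck_on k (\<lambda>x. \<Sum>c\<in>C.
        (frechet_derivative f (at x) v \<bullet> c / (c \<bullet> c)) *\<^sub>R frechet_derivative g (at (f x)) c) S"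
      by (intro Ck_on_sum[OF S] Ck_on_bilinear[OF bounded_bilinear_scaleR S])
  qed
qed

lemma finite_span_prod:
  fixes B :: "'a::real_vector set" and C :: "'b::real_vector set"
  assumes "finite B" "span B = UNIV" "finite C" "span C = UNIV"
  obtains D :: "('a \<times> 'b) set" where "finite D" "span D = UNIV"
proof
  let ?D = "(\<lambda>x. (x, 0)) ` B \<union> (\<lambda>y. (0, y)) ` C"
  show "finite ?D" using assms by simp
  have "linear (\<lambda>x::'a. (x, 0::'b))" "linear (\<lambda>y::'b. (0::'a, y))"
    by (auto intro!: linearI)
  then have "span ((\<lambda>x. (x, 0::'b)) ` B) = range (\<lambda>x. (x, 0))"
    "span ((\<lambda>y. (0::'a, y)) ` C) = range (\<lambda>y. (0, y))"
    using assms by (simp_all add: linear_span_image)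
  then have "(x, 0) \<in> span ?D" "(0, y) \<in> span ?D" for x y
    by (metis Un_upper1 rangeI span_mono subsetD, metis Un_upper2 rangeI span_mono subsetD)
  then have "(x, 0) + (0, y) \<in> span ?D" for x y
    by (intro span_add)
  then show "span ?D = UNIV" by auto
qed

text \<open>Real exponents let one induction cover both later uses: reciprocals (exponent -1) and
  square roots (exponent 1/2).\<close>

lemma Ck_on_powr: "Ck_on k (\<lambda>x::real. x powr a) {0<..}"
proof (induction k arbitrary: a)
  case 0
  show ?case by (auto intro!: continuous_intros)
next
  case (Suc k)
  show ?case
  proof (rule Ck_on_SucI)
    show "((\<lambda>x. x powr a) has_derivative (\<lambda>v. (a * v) * x powr (a - 1))) (at x)"
      if "x \<in> {0<..}" for x :: real
      by (rule has_derivative_eq_rhs[OF has_real_derivative_powr[of x a, unfolded has_field_derivative_def]])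
        (use that in auto)
    show "Ck_on k (\<lambda>x::real. (a * v) * x powr (a - 1)) {0<..}" for v
      by (intro Ck_on_bounded_linear_compose[OF bounded_linear_mult_right] Suc.IH) simp
  qed simp
qed

section \<open>Parametric integrals and Hadamard's lemma\<close>

text \<open>Differentiation under the integral sign. The linearisation error must be small uniformly
  in \<open>t\<close> and in the direction \<open>v\<close>: compactness of the interval handles
  \<open>t\<close>, and the finite expansion along \<open>C\<close> reduces all \<open>v\<close> to
  finitely many directions.\<close>

lemma has_derivative_integral_param:
  fixes \<Phi> :: "'a::real_inner \<times> real \<Rightarrow> real"
  assumes fin: "finite (B::'a set)" "span B = UNIV"
    and T: "open T" "T \<times> {0..1} \<subseteq> \<Omega>" and C1: "Ck_on (Suc 0) \<Phi> \<Omega>" and x0: "x0 \<in> T"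
  shows "((\<lambda>x. integral {0..1} (\<lambda>t. \<Phi> (x, t))) has_derivative
     (\<lambda>v. integral {0..1} (\<lambda>t. frechet_derivative \<Phi> (at (x0, t)) (v, 0)))) (at x0)"
proof -
  obtain C :: "'a set" where C: "finite C" "0 \<notin> C" "\<And>x::'a. x = (\<Sum>c\<in>C. (x \<bullet> c / (c \<bullet> c)) *\<^sub>R c)"
    using finite_dim_expansion[OF fin] by metis
  define D where "D v y = frechet_derivative \<Phi> (at y) (v, 0)" for v y
  have der: "((\<lambda>x. \<Phi> (x, t)) has_derivative (\<lambda>v. D v (x, t))) (at x)"
    if "x \<in> T" "t \<in> {0..1}" for x t
  proof -
    have "((\<lambda>x. (x, t)) has_derivative (\<lambda>v. (v, 0))) (at x)"
      by (auto intro!: derivative_eq_intros)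
    moreover have "(\<Phi> has_derivative frechet_derivative \<Phi> (at (x, t))) (at (x, t))"
      using that T by (intro Ck_on_Suc_has_derivative[OF C1]) auto
    ultimately show ?thesis unfolding D_def by (rule has_derivative_compose)
  qed
  have contD: "continuous_on (T \<times> {0..1}) (D v)" for v
    unfolding D_def using C1 by (intro continuous_on_subset[OF _ T(2)]) simp
  have cont\<Phi>: "continuous_on (T \<times> {0..1}) \<Phi>"
    using Ck_on_imp_continuous_on[OF C1] T(2) continuous_on_subset by blast
  have cont1: "continuous_on {0..1} (\<lambda>t. D v (x, t))" "continuous_on {0..1} (\<lambda>t. \<Phi> (x, t))"
    if "x \<in> T" for v x
    using that by (auto intro!: continuous_on_compose2[OF contD] continuous_on_compose2[OF cont\<Phi>]
        continuous_intros)
  have lin: "D v (x, t) = (\<Sum>c\<in>C. (v \<bullet> c / (c \<bullet> c)) * D c (x, t))" if "x \<in> T" "t \<in> {0..1}" for v x t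
    using bounded_linear_expansion[OF C(3) has_derivative_bounded_linear[OF der[OF that]], of v]
    by simp
  \<comment> \<open>A finite combination of coordinate functionals: this form shows that the
    candidate derivative is bounded linear.\<close>
  have int_lin: "integral {0..1} (\<lambda>t. D v (x0, t)) =
      (\<Sum>c\<in>C. (v \<bullet> c / (c \<bullet> c)) * integral {0..1} (\<lambda>t. D c (x0, t)))" for v
  proof -
    have "integral {0..1} (\<lambda>t. D v (x0, t)) =
        integral {0..1} (\<lambda>t. \<Sum>c\<in>C. (v \<bullet> c / (c \<bullet> c)) * D c (x0, t))"
      using lin[OF x0] by (intro integral_cong) auto
    also have "\<dots> = (\<Sum>c\<in>C. integral {0..1} (\<lambda>t. (v \<bullet> c / (c \<bullet> c)) * D c (x0, t)))"
      by (intro integral_sum C integrable_continuous_interval continuous_on_mult_left cont1 x0)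
    finally show ?thesis by simp
  qed
  have int_eq: "(\<lambda>v. integral {0..1} (\<lambda>t. D v (x0, t))) =
      (\<lambda>v. \<Sum>c\<in>C. (v \<bullet> c / (c \<bullet> c)) * integral {0..1} (\<lambda>t. D c (x0, t)))"
    by (rule ext) (rule int_lin)
  have bl: "bounded_linear (\<lambda>v. integral {0..1} (\<lambda>t. D v (x0, t)))"
    unfolding int_eq
    by (intro bounded_linear_sum bounded_linear_compose[OF bounded_linear_mult_left]
        bounded_linear_compose[OF bounded_linear_divide bounded_linear_inner_left])
  have "\<exists>d>0. \<forall>y. norm (y - x0) < d \<longrightarrow> norm (integral {0..1} (\<lambda>t. \<Phi> (y, t)) -
      integral {0..1} (\<lambda>t. \<Phi> (x0, t)) - integral {0..1} (\<lambda>t. D (y - x0) (x0, t))) \<le> e * norm (y - x0)"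
    if "e > 0" for e
  proof -
    \<comment> \<open>By Cauchy-Schwarz the coefficient of \<open>c\<close> in the expansion of
      \<open>v\<close> is at most \<open>norm v / norm c\<close>, so the sum bounds all coefficients
      together. The summand 1 keeps \<open>K\<close> positive when \<open>C\<close> is
      empty.\<close>
    define K where "K = 1 + (\<Sum>c\<in>C. inverse (norm c))"
    have "K > 0" unfolding K_def by (intro add_pos_nonneg sum_nonneg) auto
    with \<open>e > 0\<close> have eK: "e / K > 0" by simp
    \<comment> \<open>Compactness of \<open>{0..1}\<close> gives one neighbourhood of
      \<open>x0\<close> that serves every \<open>t\<close>.\<close>
    have "\<exists>X. x0 \<in> X \<and> open X \<and> (\<forall>x\<in>X \<inter> T. \<forall>t\<in>{0..1}. dist (D c (x, t)) (D c (x0, t)) \<le> e / K)" for c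
      using continuous_on_prod_compactE[OF contD compact_Icc x0 eK, of c] by metis
    then obtain X where X: "\<And>c. x0 \<in> X c" "\<And>c. open (X c)"
      "\<And>c x t. x \<in> X c \<Longrightarrow> x \<in> T \<Longrightarrow> t \<in> {0..1} \<Longrightarrow> dist (D c (x, t)) (D c (x0, t)) \<le> e / K"
      by (metis IntI)
    have "open (T \<inter> \<Inter> (X ` C))" "x0 \<in> T \<inter> \<Inter> (X ` C)"
      using X C(1) x0 T by (auto intro!: open_Int open_INT)
    then obtain d where d: "d > 0" "ball x0 d \<subseteq> T \<inter> \<Inter> (X ` C)"
      by (meson openE)
    \<comment> \<open>Mean value inequality on a ball for \<open>\<Phi>\<close> minus its
      linearisation at \<open>x0\<close>; the resulting bound does not depend on \<open>t\<close>
      and can be integrated.\<close>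
    have bound: "norm (\<Phi> (y, t) - \<Phi> (x0, t) - D (y - x0) (x0, t)) \<le> norm (y - x0) * e"
      if y: "norm (y - x0) < d" and t: "t \<in> {0..1}" for y t
    proof (rule differentiable_bound_linearization[where S = "ball x0 d" and f = "\<lambda>x. \<Phi> (x, t)"
          and f' = "\<lambda>x v. D v (x, t)"])
      show "x0 \<in> ball x0 d" using d by simp
      show "x0 + s *\<^sub>R (y - x0) \<in> ball x0 d" if "s \<in> {0..1}" for s
      proof -
        have "norm (s *\<^sub>R (y - x0)) \<le> 1 * norm (y - x0)"
          unfolding norm_scaleR using that by (intro mult_right_mono) auto
        with y show ?thesis by (simp add: dist_norm)
      qed
      show "((\<lambda>x. \<Phi> (x, t)) has_derivative (\<lambda>v. D v (x, t))) (at x within ball x0 d)"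
        if "x \<in> ball x0 d" for x
        by (rule has_derivative_at_withinI[OF der]) (use that d t in auto)
      show "onorm ((\<lambda>v. D v (x, t)) - (\<lambda>v. D v (x0, t))) \<le> e" if x: "x \<in> ball x0 d" for x
      proof (rule onorm_bound)
        show "0 \<le> e" using \<open>e > 0\<close> by simp
        fix v :: 'a
        have xT: "x \<in> T" using x d by auto
        have "norm (D v (x, t) - D v (x0, t)) =
            norm (\<Sum>c\<in>C. (v \<bullet> c / (c \<bullet> c)) * (D c (x, t) - D c (x0, t)))"
          unfolding lin[OF xT t, of v] lin[OF x0 t, of v] by (simp add: right_diff_distrib sum_subtractf)
        also have "\<dots> \<le> (\<Sum>c\<in>C. (norm v * inverse (norm c)) * (e / K))"
        proof (rule sum_norm_le)
          fix c assume c: "c \<in> C"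
          then have "norm c > 0" using C(2) by auto
          have "\<bar>v \<bullet> c\<bar> / (norm c)\<^sup>2 \<le> norm v * norm c / (norm c)\<^sup>2"
            by (intro divide_right_mono Cauchy_Schwarz_ineq2) auto
          also have "\<dots> = norm v * inverse (norm c)"
            using \<open>norm c > 0\<close> by (simp add: field_simps power2_eq_square)
          finally have "\<bar>v \<bullet> c / (c \<bullet> c)\<bar> \<le> norm v * inverse (norm c)"
            by (simp add: dot_square_norm)
          moreover have "\<bar>D c (x, t) - D c (x0, t)\<bar> \<le> e / K"
            using X(3)[of x c t] d x c t xT by (auto simp: dist_real_def)
          ultimately show "norm ((v \<bullet> c / (c \<bullet> c)) * (D c (x, t) - D c (x0, t)))
              \<le> (norm v * inverse (norm c)) * (e / K)"
            unfolding real_norm_def abs_mult by (intro mult_mono) auto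
        qed
        also have "\<dots> = (e / K) * norm v * (K - 1)"
          by (simp add: K_def sum_distrib_left sum_divide_distrib mult_ac)
        also have "\<dots> \<le> (e / K) * norm v * K"
          by (intro mult_left_mono mult_nonneg_nonneg less_imp_le[OF eK]) auto
        also have "\<dots> = e * norm v" using \<open>K > 0\<close> by simp
        finally show "norm (((\<lambda>v. D v (x, t)) - (\<lambda>v. D v (x0, t))) v) \<le> e * norm v" by simp
      qed
    qed
    show ?thesis
    proof (intro exI conjI allI impI)
      show "d > 0" by fact
      fix y assume y: "norm (y - x0) < d"
      then have yT: "y \<in> T" using d by (auto simp: dist_norm norm_minus_commute)
      have "integral {0..1} (\<lambda>t. \<Phi> (y, t)) - integral {0..1} (\<lambda>t. \<Phi> (x0, t)) -
          integral {0..1} (\<lambda>t. D (y - x0) (x0, t)) =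
          integral {0..1} (\<lambda>t. \<Phi> (y, t) - \<Phi> (x0, t) - D (y - x0) (x0, t))"
        using x0 yT
        by (simp add: integral_diff integrable_diff integrable_continuous_interval cont1)
      also have "norm \<dots> \<le> (norm (y - x0) * e) * (1 - 0)"
        using x0 yT bound[OF y] by (intro integral_bound continuous_on_diff cont1) auto
      finally show "norm (integral {0..1} (\<lambda>t. \<Phi> (y, t)) - integral {0..1} (\<lambda>t. \<Phi> (x0, t)) -
          integral {0..1} (\<lambda>t. D (y - x0) (x0, t))) \<le> e * norm (y - x0)"
        by (simp add: mult.commute)
    qed
  qed
  with bl show ?thesis
    unfolding has_derivative_at_alt D_def by blast
qed

text \<open>Each directional derivative of the integral is again such an integral, of the derivative
  of \<open>\<Phi>\<close> in direction \<open>(v, 0)\<close>, so the induction runs over all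
  \<open>\<Phi>\<close>.\<close>

lemma Ck_on_integral:
  fixes \<Phi> :: "'a::real_inner \<times> real \<Rightarrow> real"
  assumes fin: "finite (B::'a set)" "span B = UNIV"
    and T: "open T" "T \<times> {0..1} \<subseteq> \<Omega>" and "Ck_on k \<Phi> \<Omega>"
  shows "Ck_on k (\<lambda>x. integral {0..1} (\<lambda>t. \<Phi> (x, t))) T"
  using assms(5)
proof (induction k arbitrary: \<Phi>)
  case 0
  then have "continuous_on (T \<times> cbox 0 1) (\<lambda>(x, t). \<Phi> (x, t))"
    using T continuous_on_subset by auto
  from integral_continuous_on_param[OF this] show ?case by simp
next
  case (Suc k)
  show ?case
  proof (rule Ck_on_SucI[OF T(1)])
    show "((\<lambda>x. integral {0..1} (\<lambda>t. \<Phi> (x, t))) has_derivative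
      (\<lambda>v. integral {0..1} (\<lambda>t. frechet_derivative \<Phi> (at (x, t)) (v, 0)))) (at x)" if "x \<in> T" for x
      by (rule has_derivative_integral_param[OF fin T Ck_on_mono[OF Suc.prems] that]) simp
    show "Ck_on k (\<lambda>x. integral {0..1} (\<lambda>t. frechet_derivative \<Phi> (at (x, t)) (v, 0))) T" for v
      using Suc.prems by (intro Suc.IH) simp
  qed
qed

text \<open>Integrate the derivative of \<open>F\<close> along the segment from the orthogonal
  projection of \<open>x\<close> onto the hyperplane, where \<open>F\<close> vanishes, to
  \<open>x\<close> itself. The velocity is \<open>b \<bullet> x\<close> times a fixed vector, so
  that factor leaves the integral. The centre \<open>p\<close> lies on the hyperplane, which keeps
  the segment inside the ball.\<close>

lemma hadamard_hyperplane:
  fixes F :: "'a::real_inner \<Rightarrow> real"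
  assumes fin: "finite (B::'a set)" "span B = UNIV"
    and b: "b \<noteq> 0" "b \<bullet> p = 0" and F: "\<And>k. Ck_on k F (ball p r)"
    and zero: "\<And>x. x \<in> ball p r \<Longrightarrow> b \<bullet> x = 0 \<Longrightarrow> F x = 0"
  shows "\<exists>G. (\<forall>k. Ck_on k G (ball p r)) \<and> (\<forall>x\<in>ball p r. F x = (b \<bullet> x) * G x)"
proof -
  \<comment> \<open>Scaled so that \<open>b \<bullet> c = 1\<close>; then
    \<open>b \<bullet> \<pi> (x, t) = t * (b \<bullet> x)\<close>, so \<open>t = 0\<close> is the
    projection and \<open>t = 1\<close> is \<open>x\<close>.\<close>
  define c where "c = b /\<^sub>R (b \<bullet> b)"
  have bc: "b \<bullet> c = 1" using b by (simp add: c_def)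
  define \<pi> where "\<pi> y = fst y + ((snd y - 1) * (b \<bullet> fst y)) *\<^sub>R c" for y :: "'a \<times> real"
  \<comment> \<open>An open set around \<open>ball p r \<times> {0..1}\<close>, so that full
    derivatives in \<open>(x, t)\<close> exist also at the end points of the interval.\<close>
  define \<Omega> where "\<Omega> = \<pi> -` ball p r"
  have open\<Omega>: "open \<Omega>"
    unfolding \<Omega>_def \<pi>_def[abs_def] by (intro open_vimage open_ball continuous_intros)
  have sub: "ball p r \<times> {0..1} \<subseteq> \<Omega>"
  proof clarify
    fix x :: 'a and t :: real assume x: "x \<in> ball p r" and t: "t \<in> {0..1}"
    define y where "y = x - p"
    define s where "s = b \<bullet> y"
    have "b \<bullet> x = s" using b by (simp add: s_def y_def inner_diff_right)
    then have "\<pi> (x, t) - p = y + ((t - 1) * s) *\<^sub>R c" by (simp add: \<pi>_def y_def)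
    \<comment> \<open>Pythagoras: only the component of \<open>y\<close> along \<open>b\<close>,
      whose squared length is \<open>s\<^sup>2 / (b \<bullet> b)\<close>, is scaled, and the scale
      is \<open>t\<close>.\<close>
    moreover have "(norm (y + ((t - 1) * s) *\<^sub>R c))\<^sup>2 =
        (norm y)\<^sup>2 - (1 - t\<^sup>2) * (s\<^sup>2 / (b \<bullet> b))"
      using b unfolding power2_norm_eq_inner
      by (simp add: inner_add_left inner_add_right c_def s_def[symmetric] inner_commute[of y b])
        (simp add: field_simps power2_eq_square)
    moreover have "(1 - t\<^sup>2) * (s\<^sup>2 / (b \<bullet> b)) \<ge> 0"
      using t by (intro mult_nonneg_nonneg) (auto simp: power_le_one)
    ultimately have "(norm (\<pi> (x, t) - p))\<^sup>2 \<le> (norm y)\<^sup>2" by simp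
    then have "norm (\<pi> (x, t) - p) \<le> norm y" by (rule power2_le_imp_le) simp
    with x show "(x, t) \<in> \<Omega>"
      by (simp add: \<Omega>_def y_def dist_norm norm_minus_commute)
  qed
  have ck\<pi>: "Ck_on k \<pi> \<Omega>" for k
    unfolding \<pi>_def[abs_def] using open\<Omega>
    by (intro Ck_on_add Ck_on_bounded_linear_compose[OF bounded_linear_scaleR_left]
        Ck_on_bilinear[OF bounded_bilinear_mult] Ck_on_bounded_linear Ck_on_const
        Ck_on_add[of \<Omega> k snd "\<lambda>_. - 1", simplified]
        bounded_linear_compose[OF bounded_linear_inner_right] bounded_linear_fst bounded_linear_snd)
  \<comment> \<open>The derivative of \<open>F (\<pi> (x, t))\<close> in \<open>t\<close> is
    \<open>(b \<bullet> x) * \<Phi> (x, t)\<close>.\<close>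
  define \<Phi> where "\<Phi> y = frechet_derivative F (at (\<pi> y)) c" for y
  have ck\<Phi>: "Ck_on k \<Phi> \<Omega>" for k
    unfolding \<Phi>_def[abs_def]
    by (rule Ck_on_compose[OF fin open\<Omega> ck\<pi>, where T = "ball p r"])
      (use F[of "Suc k"] in \<open>auto simp: \<Omega>_def\<close>)
  have "Ck_on k (\<lambda>x. integral {0..1} (\<lambda>t. \<Phi> (x, t))) (ball p r)" for k
    by (rule Ck_on_integral[OF fin open_ball sub ck\<Phi>])
  moreover have "F x = (b \<bullet> x) * integral {0..1} (\<lambda>t. \<Phi> (x, t))" if x: "x \<in> ball p r" for x
  proof -
    have "((\<lambda>t. F (\<pi> (x, t))) has_vector_derivative (b \<bullet> x) * \<Phi> (x, t)) (at t within {0..1})"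
      if t: "t \<in> {0..1}" for t
    proof -
      have der: "(F has_derivative frechet_derivative F (at (\<pi> (x, t)))) (at (\<pi> (x, t)))"
      proof (rule Ck_on_Suc_has_derivative[OF F[of "Suc 0"]])
        have "(x, t) \<in> \<Omega>" using sub x t by auto
        then show "\<pi> (x, t) \<in> ball p r" by (simp add: \<Omega>_def)
      qed
      have "((\<lambda>t. \<pi> (x, t)) has_derivative (\<lambda>h. (h * (b \<bullet> x)) *\<^sub>R c)) (at t within {0..1})"
        unfolding \<pi>_def by (auto intro!: derivative_eq_intros)
      from has_derivative_compose[OF this der]
      have "((\<lambda>t. F (\<pi> (x, t))) has_derivative
          (\<lambda>h. frechet_derivative F (at (\<pi> (x, t))) ((h * (b \<bullet> x)) *\<^sub>R c))) (at t within {0..1})" .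
      moreover have "frechet_derivative F (at (\<pi> (x, t))) ((h * (b \<bullet> x)) *\<^sub>R c) =
          h * ((b \<bullet> x) * \<Phi> (x, t))" for h
        using linear_scale[OF has_derivative_linear[OF der]] by (simp add: \<Phi>_def)
      ultimately show ?thesis
        by (simp add: has_vector_derivative_def)
    qed
    then have "((\<lambda>t. (b \<bullet> x) * \<Phi> (x, t)) has_integral F (\<pi> (x, 1)) - F (\<pi> (x, 0))) {0..1}"
      by (intro fundamental_theorem_of_calculus) auto
    moreover have "F (\<pi> (x, 0)) = 0"
    proof (rule zero)
      have "(x, 0) \<in> \<Omega>" using sub x by auto
      then show "\<pi> (x, 0) \<in> ball p r" by (simp add: \<Omega>_def)
      show "b \<bullet> \<pi> (x, 0) = 0" by (simp add: \<pi>_def inner_diff_right bc)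
    qed
    moreover have "\<pi> (x, 1) = x" by (simp add: \<pi>_def)
    ultimately show ?thesis by (simp add: has_integral_iff)
  qed
  ultimately show ?thesis by (intro exI[of _ "\<lambda>x. integral {0..1} (\<lambda>t. \<Phi> (x, t))"]) simp
qed

section \<open>Smooth maps between manifolds\<close>

lemma smooth_onE:
  assumes "smooth_on A f" "x \<in> A"
  obtains T g where "open T" "x \<in> T" "\<And>k. Ck_on k g T" "\<And>y. y \<in> A \<Longrightarrow> y \<in> T \<Longrightarrow> g y = f y"
proof -
  obtain T g where *: "open T \<and> x \<in> T \<and> (\<forall>k. Ck_on k g T) \<and> (\<forall>y\<in>A \<inter> T. g y = f y)"
    using bspec[OF assms(1)[unfolded smooth_on_def] assms(2)] by (elim exE)
  show thesis by (rule that[of T g]) (use * in auto)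
qed

lemma smooth_onI:
  assumes "\<And>x. x \<in> A \<Longrightarrow>
    \<exists>T g. open T \<and> x \<in> T \<and> (\<forall>k. Ck_on k g T) \<and> (\<forall>y\<in>A \<inter> T. g y = f y)"
  shows "smooth_on A f"
  unfolding smooth_on_def using assms by (rule ballI)

lemma smooth_on_subset_cong:
  assumes "smooth_on B f" "A \<subseteq> B" "\<And>x. x \<in> A \<Longrightarrow> f x = g x"
  shows "smooth_on A g"
proof (rule smooth_onI)
  fix x assume "x \<in> A"
  then have "x \<in> B" using assms(2) by blast
  obtain T h where "open T" "x \<in> T" "\<And>k. Ck_on k h T" "\<And>y. y \<in> B \<Longrightarrow> y \<in> T \<Longrightarrow> h y = f y"
    by (rule smooth_onE[OF assms(1) \<open>x \<in> B\<close>]) blast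
  then show "\<exists>T h. open T \<and> x \<in> T \<and> (\<forall>k. Ck_on k h T) \<and> (\<forall>y\<in>A \<inter> T. h y = g y)"
    using assms(2,3) by (intro exI[of _ T] exI[of _ h]) auto
qed

lemma smooth_on_subset: "smooth_on B f \<Longrightarrow> A \<subseteq> B \<Longrightarrow> smooth_on A f"
  by (rule smooth_on_subset_cong) auto

lemma smooth_on_cong: "smooth_on A f \<Longrightarrow> (\<And>x. x \<in> A \<Longrightarrow> f x = g x) \<Longrightarrow> smooth_on A g"
  by (rule smooth_on_subset_cong[OF _ subset_refl])

lemma smooth_on_local:
  assumes "\<And>x. x \<in> A \<Longrightarrow> \<exists>T. open T \<and> x \<in> T \<and> smooth_on (A \<inter> T) f"
  shows "smooth_on A f"
proof (rule smooth_onI)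
  fix x assume "x \<in> A"
  from assms[OF this] obtain T where T: "open T" "x \<in> T" "smooth_on (A \<inter> T) f" by blast
  with \<open>x \<in> A\<close> have "x \<in> A \<inter> T" by simp
  obtain T' g where T': "open T'" "x \<in> T'" "\<And>k. Ck_on k g T'"
    "\<And>y. y \<in> A \<inter> T \<Longrightarrow> y \<in> T' \<Longrightarrow> g y = f y"
    by (rule smooth_onE[OF T(3) \<open>x \<in> A \<inter> T\<close>]) blast
  then show "\<exists>T g. open T \<and> x \<in> T \<and> (\<forall>k. Ck_on k g T) \<and> (\<forall>y\<in>A \<inter> T. g y = f y)"
    using T by (intro exI[of _ "T \<inter> T'"] exI[of _ g]) (auto intro: Ck_on_subset)
qed

lemma Ck_on_imp_smooth_on: "open T \<Longrightarrow> (\<And>k. Ck_on k f T) \<Longrightarrow> smooth_on T f"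
  unfolding smooth_on_def by blast

lemma smooth_on_bounded_linear: "bounded_linear L \<Longrightarrow> smooth_on A L"
  by (rule smooth_on_subset[OF Ck_on_imp_smooth_on[OF open_UNIV]]) (auto intro: Ck_on_bounded_linear)

lemma smooth_on_Pair:
  assumes "smooth_on A f" "smooth_on A g"
  shows "smooth_on A (\<lambda>x. (f x, g x))"
proof (rule smooth_onI)
  fix x assume "x \<in> A"
  obtain T f' where
    T: "open T" "x \<in> T" "\<And>k. Ck_on k f' T" "\<And>y. y \<in> A \<Longrightarrow> y \<in> T \<Longrightarrow> f' y = f y"
    by (rule smooth_onE[OF assms(1) \<open>x \<in> A\<close>]) blast
  obtain T' g' where
    T': "open T'" "x \<in> T'" "\<And>k. Ck_on k g' T'" "\<And>y. y \<in> A \<Longrightarrow> y \<in> T' \<Longrightarrow> g' y = g y"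
    by (rule smooth_onE[OF assms(2) \<open>x \<in> A\<close>]) blast
  have "Ck_on k (\<lambda>x. (f' x, g' x)) (T \<inter> T')" for k
    using T T' by (intro Ck_on_Pair Ck_on_subset[OF T(3)] Ck_on_subset[OF T'(3)]) auto
  with T T'
  show "\<exists>T h. open T \<and> x \<in> T \<and> (\<forall>k. Ck_on k h T) \<and> (\<forall>y\<in>A \<inter> T. h y = (f y, g y))"
    by (intro exI[of _ "T \<inter> T'"] exI[of _ "\<lambda>x. (f' x, g' x)"]) auto
qed

lemma smooth_on_compose:
  fixes f :: "'a::real_normed_vector \<Rightarrow> 'b::real_inner" and g :: "'b \<Rightarrow> 'c::real_normed_vector"
  assumes fin: "finite (D::'b set)" "span D = UNIV"
    and f: "smooth_on A f" and g: "smooth_on B g" and sub: "f ` A \<subseteq> B"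
  shows "smooth_on A (\<lambda>x. g (f x))"
proof (rule smooth_onI)
  fix x assume x: "x \<in> A"
  obtain T f' where
    T: "open T" "x \<in> T" "\<And>k. Ck_on k f' T" "\<And>y. y \<in> A \<Longrightarrow> y \<in> T \<Longrightarrow> f' y = f y"
    by (rule smooth_onE[OF f x]) blast
  have "f x \<in> B" using x sub by blast
  obtain T' g' where
    T': "open T'" "f x \<in> T'" "\<And>k. Ck_on k g' T'" "\<And>y. y \<in> B \<Longrightarrow> y \<in> T' \<Longrightarrow> g' y = g y"
    by (rule smooth_onE[OF g \<open>f x \<in> B\<close>]) blast
  \<comment> \<open>Off \<open>A\<close> the extension \<open>f'\<close> may leave the domain of
    \<open>g'\<close>; passing to the preimage of \<open>T'\<close> prevents this.\<close>
  let ?S = "T \<inter> f' -` T'"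
  have "open ?S"
    using continuous_open_preimage[OF Ck_on_imp_continuous_on[OF T(3)[of 0]] T(1) T'(1)] .
  moreover have "x \<in> ?S" using T T' x by auto
  moreover have "Ck_on k (\<lambda>x. g' (f' x)) ?S" for k
    using \<open>open ?S\<close> by (rule Ck_on_compose[OF fin _ Ck_on_subset[OF T(3)] T'(3)]) auto
  moreover have "\<forall>y\<in>A \<inter> ?S. g' (f' y) = g (f y)" using T T' sub by auto
  ultimately show "\<exists>T h. open T \<and> x \<in> T \<and> (\<forall>k. Ck_on k h T) \<and> (\<forall>y\<in>A \<inter> T. h y = g (f y))"
    by blast
qed

text \<open>Unlike \<open>is_bmanifold\<close>, this imposes no half-space condition on the images of the charts,
  so it is preserved by products.\<close>

definition smooth_atlas :: "('a, 'e::real_inner, 'm) bmanifold_scheme \<Rightarrow> bool" where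
  "smooth_atlas M \<longleftrightarrow>
     (\<exists>B::'e set. finite B \<and> span B = UNIV) \<and>
     (\<forall>p\<in>topspace (mtop M). \<exists>U \<phi>. (U, \<phi>) \<in> charts M \<and> p \<in> U) \<and>
     (\<forall>U \<phi>. (U, \<phi>) \<in> charts M \<longrightarrow> openin (mtop M) U \<and>
        homeomorphic_map (subtopology (mtop M) U) (top_of_set (\<phi> ` U)) \<phi>) \<and>
     (\<forall>U \<phi> V \<eta>. (U, \<phi>) \<in> charts M \<longrightarrow> (V, \<eta>) \<in> charts M \<longrightarrow>
        smooth_on (\<phi> ` (U \<inter> V)) (\<eta> \<circ> inv_into U \<phi>))"

section \<open>Atlases and their charts\<close>

lemma smooth_atlasI:
  fixes M :: "('a, 'e::real_inner, 'm) bmanifold_scheme" and B :: "'e set"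
  assumes "finite B" "span B = UNIV"
    and "\<And>p. p \<in> topspace (mtop M) \<Longrightarrow> \<exists>U \<phi>. (U, \<phi>) \<in> charts M \<and> p \<in> U"
    and "\<And>U \<phi>. (U, \<phi>) \<in> charts M \<Longrightarrow> openin (mtop M) U"
    and "\<And>U \<phi>. (U, \<phi>) \<in> charts M \<Longrightarrow>
      homeomorphic_map (subtopology (mtop M) U) (top_of_set (\<phi> ` U)) \<phi>"
    and "\<And>U \<phi> V \<eta>. (U, \<phi>) \<in> charts M \<Longrightarrow> (V, \<eta>) \<in> charts M \<Longrightarrow>
      smooth_on (\<phi> ` (U \<inter> V)) (\<eta> \<circ> inv_into U \<phi>)"
  shows "smooth_atlas M"
  unfolding smooth_atlas_def
  by (intro conjI exI[of _ B] ballI allI impI assms)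

lemma smooth_atlas_finite_dim:
  fixes M :: "('a, 'e::real_inner, 'm) bmanifold_scheme"
  assumes "smooth_atlas M"
  obtains B :: "'e set" where "finite B" "span B = UNIV"
  using assms unfolding smooth_atlas_def by blast

lemma smooth_atlas_chart_at:
  assumes "smooth_atlas M" "p \<in> topspace (mtop M)"
  obtains U \<phi> where "(U, \<phi>) \<in> charts M" "p \<in> U"
  using assms unfolding smooth_atlas_def by blast

lemma smooth_atlas_transition:
  assumes "smooth_atlas M" "(U, \<phi>) \<in> charts M" "(V, \<eta>) \<in> charts M"
  shows "smooth_on (\<phi> ` (U \<inter> V)) (\<eta> \<circ> inv_into U \<phi>)"
  using assms unfolding smooth_atlas_def by blast

lemma
  assumes "smooth_atlas M" "(U, \<phi>) \<in> charts M"
  shows chart_openin: "openin (mtop M) U"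
    and chart_homeomorphic: "homeomorphic_map (subtopology (mtop M) U) (top_of_set (\<phi> ` U)) \<phi>"
  using assms unfolding smooth_atlas_def by blast+

lemma is_bmanifold_imp_smooth_atlas:
  assumes "is_bmanifold M"
  shows "smooth_atlas M"
proof -
  have cover: "(\<Union>(U, \<phi>)\<in>charts M. U) = topspace (mtop M)"
    and chart: "\<forall>(U, \<phi>)\<in>charts M. openin (mtop M) U \<and>
      (\<exists>b. openin (top_of_set (halfspace b)) (\<phi> ` U)) \<and>
      homeomorphic_map (subtopology (mtop M) U) (top_of_set (\<phi> ` U)) \<phi>"
    and trans: "\<forall>(U, \<phi>)\<in>charts M. \<forall>(V, \<eta>)\<in>charts M.
      smooth_on (\<phi> ` (U \<inter> V)) (\<eta> \<circ> inv_into U \<phi>)"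
    and fin: "\<exists>B::'b set. finite B \<and> span B = UNIV"
    using assms unfolding is_bmanifold_def by simp_all
  from fin obtain B :: "'b set" where B: "finite B" "span B = UNIV" by blast
  show ?thesis
  proof (rule smooth_atlasI[OF B])
    show "\<exists>U \<phi>. (U, \<phi>) \<in> charts M \<and> p \<in> U" if "p \<in> topspace (mtop M)" for p
      using that cover by fastforce
  qed (use chart trans in fast)+
qed

lemma chart_subset: "smooth_atlas M \<Longrightarrow> (U, \<phi>) \<in> charts M \<Longrightarrow> U \<subseteq> topspace (mtop M)"
  by (simp add: chart_openin openin_subset)

lemma chart_inj_on: "smooth_atlas M \<Longrightarrow> (U, \<phi>) \<in> charts M \<Longrightarrow> inj_on \<phi> U"
  using homeomorphic_imp_injective_map[OF chart_homeomorphic] chart_subset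
  by (metis inf.absorb_iff2 topspace_subtopology)

lemma chart_inv_into:
  "smooth_atlas M \<Longrightarrow> (U, \<phi>) \<in> charts M \<Longrightarrow> x \<in> U \<Longrightarrow> inv_into U \<phi> (\<phi> x) = x"
  by (simp add: chart_inj_on)

lemma chart_openin_vimage:
  assumes "smooth_atlas M" "(U, \<phi>) \<in> charts M" "open T"
  shows "openin (mtop M) {x \<in> U. \<phi> x \<in> T}"
proof -
  have "continuous_map (subtopology (mtop M) U) (top_of_set (\<phi> ` U)) \<phi>"
    using chart_homeomorphic[OF assms(1,2)] homeomorphic_imp_continuous_map by blast
  then have "openin (subtopology (mtop M) U) {x \<in> topspace (subtopology (mtop M) U). \<phi> x \<in> \<phi> ` U \<inter> T}"
    by (rule openin_continuous_map_preimage) (use assms(3) in \<open>auto simp: openin_open\<close>)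
  moreover have "{x \<in> topspace (subtopology (mtop M) U). \<phi> x \<in> \<phi> ` U \<inter> T} = {x \<in> U. \<phi> x \<in> T}"
    using chart_subset[OF assms(1,2)] by auto
  ultimately show ?thesis
    using chart_openin[OF assms(1,2)] by (metis openin_trans_full)
qed

text \<open>Turns open sets of the manifold into open sets of the model space, as the local
  smoothness criterion \<open>smooth_on_local\<close> requires.\<close>

lemma chart_open_image:
  assumes "smooth_atlas M" "(U, \<phi>) \<in> charts M" "openin (mtop M) W"
  obtains T where "open T" "\<phi> ` (U \<inter> W) = \<phi> ` U \<inter> T"
proof -
  have "openin (subtopology (mtop M) U) (U \<inter> W)"
    using assms(3) by (simp add: openin_subtopology_Int2)
  then have "openin (top_of_set (\<phi> ` U)) (\<phi> ` (U \<inter> W))"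
    using homeomorphic_imp_open_map[OF chart_homeomorphic[OF assms(1,2)]]
    unfolding open_map_def by blast
  with that show thesis unfolding openin_open by blast
qed

text \<open>Restricting a chart changes its domain but not its coordinate map, and
  \<open>inv_into\<close> depends on the domain; this reconciles the two inverses.\<close>

lemma inv_into_Int:
  assumes "inj_on f U" "y \<in> f ` (U \<inter> W)"
  shows "inv_into (U \<inter> W) f y = inv_into U f y"
  using assms by (auto simp: inv_into_f_f inj_on_Int)

section \<open>Smooth maps and their composition\<close>

lemma smooth_mapI:
  assumes "continuous_map (mtop M) (mtop N) F"
    and "\<And>U \<phi> V \<eta>. (U, \<phi>) \<in> charts M \<Longrightarrow> (V, \<eta>) \<in> charts N \<Longrightarrow>
      smooth_on (\<phi> ` (U \<inter> F -` V)) (\<eta> \<circ> F \<circ> inv_into U \<phi>)"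
  shows "smooth_map M N F"
  unfolding smooth_map_def
  by (intro conjI assms(1) ballI) (clarsimp, rule assms(2))

lemma smooth_map_chart:
  assumes "smooth_map M N F" "(U, \<phi>) \<in> charts M" "(V, \<eta>) \<in> charts N"
  shows "smooth_on (\<phi> ` (U \<inter> F -` V)) (\<eta> \<circ> F \<circ> inv_into U \<phi>)"
  using assms unfolding smooth_map_def by fast

lemma smooth_map_continuous: "smooth_map M N F \<Longrightarrow> continuous_map (mtop M) (mtop N) F"
  by (simp add: smooth_map_def)

lemma smooth_map_cong:
  assumes "smooth_atlas M" "smooth_map M N F" "\<And>x. x \<in> topspace (mtop M) \<Longrightarrow> F x = G x"
  shows "smooth_map M N G"
proof -
  have "smooth_on (\<phi> ` (U \<inter> G -` V)) (\<eta> \<circ> G \<circ> inv_into U \<phi>)"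
    if c: "(U, \<phi>) \<in> charts M" "(V, \<eta>) \<in> charts N" for U \<phi> V \<eta>
  proof -
    have "U \<inter> G -` V = U \<inter> F -` V" using chart_subset[OF assms(1) c(1)] assms(3) by auto
    moreover have "smooth_on (\<phi> ` (U \<inter> F -` V)) (\<eta> \<circ> F \<circ> inv_into U \<phi>)"
      by (rule smooth_map_chart[OF assms(2) c])
    ultimately have "smooth_on (\<phi> ` (U \<inter> G -` V)) (\<eta> \<circ> F \<circ> inv_into U \<phi>)" by simp
    then show ?thesis
      by (rule smooth_on_cong)
        (use chart_subset[OF assms(1) c(1)] in
          \<open>auto simp: chart_inv_into[OF assms(1) c(1)] assms(3) subset_iff\<close>)
  qed
  moreover have "continuous_map (mtop M) (mtop N) G"
    using smooth_map_continuous[OF assms(2)] assms(3) by (rule continuous_map_eq)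
  ultimately show ?thesis by (rule smooth_mapI[rotated])
qed

lemma smooth_map_compose:
  fixes N :: "('b, 'f::real_inner, 'n) bmanifold_scheme"
  assumes M: "smooth_atlas M" and N: "smooth_atlas N" and F: "smooth_map M N F" and G: "smooth_map N P G"
  shows "smooth_map M P (\<lambda>x. G (F x))"
proof -
  have "smooth_on (\<phi> ` (U \<inter> (\<lambda>x. G (F x)) -` W)) (\<zeta> \<circ> (\<lambda>x. G (F x)) \<circ> inv_into U \<phi>)"
    if U: "(U, \<phi>) \<in> charts M" and W: "(W, \<zeta>) \<in> charts P" for U \<phi> W \<zeta>
  proof (rule smooth_on_local)
    fix x assume "x \<in> \<phi> ` (U \<inter> (\<lambda>x. G (F x)) -` W)"
    then obtain p where p: "x = \<phi> p" "p \<in> U" "G (F p) \<in> W" by auto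
    have cont: "continuous_map (mtop M) (mtop N) F" using F by (simp add: smooth_map_def)
    then have "F p \<in> topspace (mtop N)"
      using p(2) chart_subset[OF M U] by (auto simp: continuous_map_def)
    then obtain V \<eta> where V: "(V, \<eta>) \<in> charts N" "F p \<in> V"
      using smooth_atlas_chart_at[OF N] by metis
    \<comment> \<open>One chart of \<open>N\<close> does not cover the whole image of
      \<open>U\<close>, so the argument is localised to where \<open>F\<close> takes values in the
      single chart domain \<open>V\<close>.\<close>
    have "openin (mtop M) {q \<in> topspace (mtop M). F q \<in> V}"
      using cont chart_openin[OF N V(1)] by (rule openin_continuous_map_preimage)
    then obtain T where T: "open T" "\<phi> ` (U \<inter> {q \<in> topspace (mtop M). F q \<in> V}) = \<phi> ` U \<inter> T"
      using chart_open_image[OF M U] by metis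
    have "x \<in> T" using T(2) p V(2) chart_subset[OF M U] by blast
    let ?A = "\<phi> ` (U \<inter> (\<lambda>x. G (F x)) -` W) \<inter> T"
    have A: "\<exists>q\<in>U. y = \<phi> q \<and> F q \<in> V \<and> G (F q) \<in> W" if y: "y \<in> ?A" for y
    proof -
      have "y \<in> \<phi> ` (U \<inter> {q \<in> topspace (mtop M). F q \<in> V})" using y T(2) by blast
      then show ?thesis
        using y chart_inj_on[OF M U] by (auto dest: inj_onD)
    qed
    obtain B where B: "finite B" "span B = (UNIV :: 'f set)"
      using smooth_atlas_finite_dim[OF N] by metis
    have "smooth_on (\<phi> ` (U \<inter> F -` V)) (\<eta> \<circ> F \<circ> inv_into U \<phi>)"
      by (rule smooth_map_chart[OF F U V(1)])
    then have 1: "smooth_on ?A (\<eta> \<circ> F \<circ> inv_into U \<phi>)"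
      by (rule smooth_on_subset) (use A in blast)
    have 2: "smooth_on (\<eta> ` (V \<inter> G -` W)) (\<zeta> \<circ> G \<circ> inv_into V \<eta>)"
      by (rule smooth_map_chart[OF G V(1) W])
    have A': "(\<eta> \<circ> F \<circ> inv_into U \<phi>) y \<in> \<eta> ` (V \<inter> G -` W)"
      "(\<zeta> \<circ> G \<circ> inv_into V \<eta>) ((\<eta> \<circ> F \<circ> inv_into U \<phi>) y) = (\<zeta> \<circ> (\<lambda>x. G (F x)) \<circ> inv_into U \<phi>) y"
      if y: "y \<in> ?A" for y
    proof -
      obtain q where q: "q \<in> U" "y = \<phi> q" "F q \<in> V" "G (F q) \<in> W" using A[OF y] by blast
      then show "(\<eta> \<circ> F \<circ> inv_into U \<phi>) y \<in> \<eta> ` (V \<inter> G -` W)"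
        "(\<zeta> \<circ> G \<circ> inv_into V \<eta>) ((\<eta> \<circ> F \<circ> inv_into U \<phi>) y) = (\<zeta> \<circ> (\<lambda>x. G (F x)) \<circ> inv_into U \<phi>) y"
        by (simp_all add: chart_inv_into[OF M U] chart_inv_into[OF N V(1)])
    qed
    have "smooth_on ?A (\<lambda>y. (\<zeta> \<circ> G \<circ> inv_into V \<eta>) ((\<eta> \<circ> F \<circ> inv_into U \<phi>) y))"
      using A'(1) by (intro smooth_on_compose[OF B 1 2] image_subsetI)
    then have "smooth_on ?A (\<zeta> \<circ> (\<lambda>x. G (F x)) \<circ> inv_into U \<phi>)"
      using A'(2) by (rule smooth_on_cong)
    then show "\<exists>T. open T \<and> x \<in> T \<and>
        smooth_on (\<phi> ` (U \<inter> (\<lambda>x. G (F x)) -` W) \<inter> T) (\<zeta> \<circ> (\<lambda>x. G (F x)) \<circ> inv_into U \<phi>)"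
      using T(1) \<open>x \<in> T\<close> by blast
  qed
  moreover have "continuous_map (mtop M) (mtop P) (\<lambda>x. G (F x))"
    using continuous_map_compose[OF F[THEN smooth_map_continuous] G[THEN smooth_map_continuous]]
    by (simp add: o_def)
  ultimately show ?thesis by (rule smooth_mapI[rotated])
qed

section \<open>Open submanifolds\<close>

lemma mtop_open_submanifold: "mtop (open_submanifold M W) = subtopology (mtop M) W"
  by (simp add: open_submanifold_def)

lemma charts_open_submanifold_iff:
  "(Z, \<phi>) \<in> charts (open_submanifold M W) \<longleftrightarrow> (\<exists>U. (U, \<phi>) \<in> charts M \<and> Z = U \<inter> W)"
  by (auto simp: open_submanifold_def)

lemma smooth_atlas_open_submanifold:
  fixes M :: "('a, 'e::real_inner, 'm) bmanifold_scheme"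
  assumes M: "smooth_atlas M"
  shows "smooth_atlas (open_submanifold M W)"
proof -
  obtain B :: "'e set" where B: "finite B" "span B = UNIV" using smooth_atlas_finite_dim[OF M] .
  show ?thesis
  proof (rule smooth_atlasI[OF B])
    fix p assume "p \<in> topspace (mtop (open_submanifold M W))"
    then have p: "p \<in> topspace (mtop M)" "p \<in> W" by (simp_all add: mtop_open_submanifold)
    obtain U \<phi> where "(U, \<phi>) \<in> charts M" "p \<in> U" using smooth_atlas_chart_at[OF M p(1)] .
    with p(2) show "\<exists>U \<phi>. (U, \<phi>) \<in> charts (open_submanifold M W) \<and> p \<in> U"
      unfolding charts_open_submanifold_iff by blast
  next
    fix Z \<phi> assume "(Z, \<phi>) \<in> charts (open_submanifold M W)"
    then obtain U where U: "(U, \<phi>) \<in> charts M" and Z: "Z = U \<inter> W"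
      unfolding charts_open_submanifold_iff by blast
    show "openin (mtop (open_submanifold M W)) Z"
      using chart_openin[OF M U] by (simp add: Z mtop_open_submanifold openin_subtopology_Int)
    have "\<phi> ` (topspace (subtopology (mtop M) U) \<inter> (U \<inter> W)) = topspace (top_of_set (\<phi> ` U)) \<inter> \<phi> ` (U \<inter> W)"
      using chart_subset[OF M U] by auto
    from homeomorphic_map_subtopologies[OF chart_homeomorphic[OF M U] this]
    have "homeomorphic_map (subtopology (subtopology (mtop M) U) (U \<inter> W))
        (subtopology (top_of_set (\<phi> ` U)) (\<phi> ` (U \<inter> W))) \<phi>" .
    moreover have "\<phi> ` U \<inter> \<phi> ` (U \<inter> W) = \<phi> ` (U \<inter> W)" "U \<inter> (U \<inter> W) = U \<inter> W" "W \<inter> (U \<inter> W) = U \<inter> W"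
      by auto
    ultimately show "homeomorphic_map (subtopology (mtop (open_submanifold M W)) Z) (top_of_set (\<phi> ` Z)) \<phi>"
      by (simp add: Z mtop_open_submanifold subtopology_subtopology)
  next
    fix Z \<phi> Z' \<phi>'
    assume "(Z, \<phi>) \<in> charts (open_submanifold M W)" "(Z', \<phi>') \<in> charts (open_submanifold M W)"
    then obtain U U' where U: "(U, \<phi>) \<in> charts M" "(U', \<phi>') \<in> charts M"
      and Z: "Z = U \<inter> W" "Z' = U' \<inter> W" unfolding charts_open_submanifold_iff by blast
    show "smooth_on (\<phi> ` (Z \<inter> Z')) (\<phi>' \<circ> inv_into Z \<phi>)"
    proof (rule smooth_on_subset_cong[OF smooth_atlas_transition[OF M U]])
      show "(\<phi>' \<circ> inv_into U \<phi>) y = (\<phi>' \<circ> inv_into Z \<phi>) y" if "y \<in> \<phi> ` (Z \<inter> Z')" for y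
        using that inv_into_Int[OF chart_inj_on[OF M U(1)], of y W] by (auto simp: Z)
    qed (auto simp: Z)
  qed
qed

lemma smooth_map_open_submanifold_source:
  assumes M: "smooth_atlas M" and F: "smooth_map M N F"
  shows "smooth_map (open_submanifold M W) N F"
proof (rule smooth_mapI)
  show "continuous_map (mtop (open_submanifold M W)) (mtop N) F"
    using smooth_map_continuous[OF F] by (simp add: mtop_open_submanifold continuous_map_from_subtopology)
  fix Z \<phi> V \<eta> assume "(Z, \<phi>) \<in> charts (open_submanifold M W)" and V: "(V, \<eta>) \<in> charts N"
  then obtain U where U: "(U, \<phi>) \<in> charts M" and Z: "Z = U \<inter> W"
    unfolding charts_open_submanifold_iff by blast
  show "smooth_on (\<phi> ` (Z \<inter> F -` V)) (\<eta> \<circ> F \<circ> inv_into Z \<phi>)"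
  proof (rule smooth_on_subset_cong[OF smooth_map_chart[OF F U V]])
    show "(\<eta> \<circ> F \<circ> inv_into U \<phi>) y = (\<eta> \<circ> F \<circ> inv_into Z \<phi>) y" if "y \<in> \<phi> ` (Z \<inter> F -` V)" for y
      using that inv_into_Int[OF chart_inj_on[OF M U], of y W] by (auto simp: Z)
  qed (auto simp: Z)
qed

lemma smooth_map_open_submanifold_target:
  assumes F: "smooth_map M N F" and W: "F ` topspace (mtop M) \<subseteq> W"
  shows "smooth_map M (open_submanifold N W) F"
proof (rule smooth_mapI)
  show "continuous_map (mtop M) (mtop (open_submanifold N W)) F"
    using smooth_map_continuous[OF F] W
    by (auto simp: mtop_open_submanifold continuous_map_in_subtopology)
  fix U \<phi> Z \<eta> assume U: "(U, \<phi>) \<in> charts M" and "(Z, \<eta>) \<in> charts (open_submanifold N W)"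
  then obtain V where V: "(V, \<eta>) \<in> charts N" and Z: "Z = V \<inter> W"
    unfolding charts_open_submanifold_iff by blast
  show "smooth_on (\<phi> ` (U \<inter> F -` Z)) (\<eta> \<circ> F \<circ> inv_into U \<phi>)"
    by (rule smooth_on_subset[OF smooth_map_chart[OF F U V]]) (auto simp: Z)
qed

section \<open>Products of manifolds\<close>

lemma inv_into_map_prod:
  assumes "inj_on \<phi> U" "inj_on \<eta> V" "x \<in> U" "y \<in> V"
  shows "inv_into (U \<times> V) (map_prod \<phi> \<eta>) (\<phi> x, \<eta> y) = (x, y)"
proof -
  have "inj_on (map_prod \<phi> \<eta>) (U \<times> V)" using assms by (simp add: map_prod_inj_on)
  from inv_into_f_f[OF this, of "(x, y)"] assms show ?thesis by simp
qed

lemma smooth_on_compose_fst: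
  fixes A :: "'a::real_inner set"
  assumes "finite (B::'a set)" "span B = UNIV" "smooth_on A f" "fst ` C \<subseteq> A"
  shows "smooth_on C (\<lambda>x. f (fst x))"
  using assms by (intro smooth_on_compose[OF assms(1,2) smooth_on_bounded_linear[OF bounded_linear_fst]])

lemma smooth_on_compose_snd:
  fixes A :: "'a::real_inner set"
  assumes "finite (B::'a set)" "span B = UNIV" "smooth_on A f" "snd ` C \<subseteq> A"
  shows "smooth_on C (\<lambda>x. f (snd x))"
  using assms by (intro smooth_on_compose[OF assms(1,2) smooth_on_bounded_linear[OF bounded_linear_snd]])

lemma mtop_prod_manifold: "mtop (prod_manifold M N) = prod_topology (mtop M) (mtop N)"
  by (simp add: prod_manifold_def)

lemma charts_prod_manifold_iff:
  "(Z, \<zeta>) \<in> charts (prod_manifold M N) \<longleftrightarrow>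
     (\<exists>U \<phi> V \<eta>. (U, \<phi>) \<in> charts M \<and> (V, \<eta>) \<in> charts N \<and> Z = U \<times> V \<and> \<zeta> = map_prod \<phi> \<eta>)"
  by (auto simp: prod_manifold_def)

lemma smooth_atlas_prod_manifold:
  fixes M :: "('a, 'e::real_inner, 'm) bmanifold_scheme" and N :: "('b, 'f::real_inner, 'n) bmanifold_scheme"
  assumes M: "smooth_atlas M" and N: "smooth_atlas N"
  shows "smooth_atlas (prod_manifold M N)"
proof -
  obtain B :: "'e set" where B: "finite B" "span B = UNIV" using smooth_atlas_finite_dim[OF M] .
  obtain C :: "'f set" where C: "finite C" "span C = UNIV" using smooth_atlas_finite_dim[OF N] .
  obtain D :: "('e \<times> 'f) set" where D: "finite D" "span D = UNIV"
    using finite_span_prod[OF B C] .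
  have cover: "\<exists>Z \<zeta>. (Z, \<zeta>) \<in> charts (prod_manifold M N) \<and> p \<in> Z"
    if p: "p \<in> topspace (mtop (prod_manifold M N))" for p
  proof -
    have p: "fst p \<in> topspace (mtop M)" "snd p \<in> topspace (mtop N)"
      using p by (auto simp: mtop_prod_manifold)
    obtain U \<phi> where U: "(U, \<phi>) \<in> charts M" "fst p \<in> U" using smooth_atlas_chart_at[OF M p(1)] .
    obtain V \<eta> where V: "(V, \<eta>) \<in> charts N" "snd p \<in> V" using smooth_atlas_chart_at[OF N p(2)] .
    have "(U \<times> V, map_prod \<phi> \<eta>) \<in> charts (prod_manifold M N)"
      using U V unfolding charts_prod_manifold_iff by blast
    moreover have "p \<in> U \<times> V" using U V by (simp add: mem_Times_iff)
    ultimately show ?thesis by blast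
  qed
  have chart: "openin (mtop (prod_manifold M N)) Z \<and>
      homeomorphic_map (subtopology (mtop (prod_manifold M N)) Z) (top_of_set (\<zeta> ` Z)) \<zeta>"
    if "(Z, \<zeta>) \<in> charts (prod_manifold M N)" for Z \<zeta>
  proof -
    from that obtain U \<phi> V \<eta> where U: "(U, \<phi>) \<in> charts M" and V: "(V, \<eta>) \<in> charts N"
      and Z: "Z = U \<times> V" "\<zeta> = map_prod \<phi> \<eta>" unfolding charts_prod_manifold_iff by blast
    obtain \<phi>' \<eta>' where
      "homeomorphic_maps (subtopology (mtop M) U) (top_of_set (\<phi> ` U)) \<phi> \<phi>'"
      "homeomorphic_maps (subtopology (mtop N) V) (top_of_set (\<eta> ` V)) \<eta> \<eta>'"
      using chart_homeomorphic[OF M U] chart_homeomorphic[OF N V] by (auto simp: homeomorphic_map_maps)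
    then have "homeomorphic_maps (prod_topology (subtopology (mtop M) U) (subtopology (mtop N) V))
        (prod_topology (top_of_set (\<phi> ` U)) (top_of_set (\<eta> ` V)))
        (\<lambda>(x, y). (\<phi> x, \<eta> y)) (\<lambda>(x, y). (\<phi>' x, \<eta>' y))"
      unfolding homeomorphic_maps_prod by blast
    moreover have "prod_topology (top_of_set (\<phi> ` U)) (top_of_set (\<eta> ` V)) = top_of_set (\<zeta> ` Z)"
      by (simp add: Z map_prod_surj_on[OF refl refl])
    moreover have "prod_topology (subtopology (mtop M) U) (subtopology (mtop N) V) =
        subtopology (mtop (prod_manifold M N)) Z"
      unfolding Z mtop_prod_manifold subtopology_Times ..
    ultimately have "homeomorphic_map (subtopology (mtop (prod_manifold M N)) Z) (top_of_set (\<zeta> ` Z)) \<zeta>"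
      unfolding homeomorphic_map_maps Z map_prod_def by metis
    with chart_openin[OF M U] chart_openin[OF N V] show ?thesis
      unfolding Z mtop_prod_manifold by (simp add: openin_prod_Times_iff)
  qed
  have trans: "smooth_on (\<zeta> ` (Z \<inter> Z')) (\<zeta>' \<circ> inv_into Z \<zeta>)"
    if "(Z, \<zeta>) \<in> charts (prod_manifold M N)" "(Z', \<zeta>') \<in> charts (prod_manifold M N)" for Z \<zeta> Z' \<zeta>'
  proof -
    from that(1) obtain U \<phi> V \<eta> where U: "(U, \<phi>) \<in> charts M" and V: "(V, \<eta>) \<in> charts N"
      and Z: "Z = U \<times> V" "\<zeta> = map_prod \<phi> \<eta>" unfolding charts_prod_manifold_iff by blast
    from that(2) obtain U' \<phi>' V' \<eta>' where U': "(U', \<phi>') \<in> charts M" and V': "(V', \<eta>') \<in> charts N"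
      and Z': "Z' = U' \<times> V'" "\<zeta>' = map_prod \<phi>' \<eta>'" unfolding charts_prod_manifold_iff by blast
    have "smooth_on (\<zeta> ` (Z \<inter> Z')) (\<lambda>z. ((\<phi>' \<circ> inv_into U \<phi>) (fst z), (\<eta>' \<circ> inv_into V \<eta>) (snd z)))"
      by (intro smooth_on_Pair smooth_on_compose_fst[OF B smooth_atlas_transition[OF M U U']]
          smooth_on_compose_snd[OF C smooth_atlas_transition[OF N V V']]) (auto simp: Z Z')
    then show ?thesis
      by (rule smooth_on_cong) (auto simp: Z Z' chart_inv_into[OF M U] chart_inv_into[OF N V]
          inv_into_map_prod[OF chart_inj_on[OF M U] chart_inj_on[OF N V]])
  qed
  show ?thesis
    by (rule smooth_atlasI[OF D cover _ _ trans]) (simp_all add: chart)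
qed

lemma smooth_map_fst:
  fixes M :: "('a, 'e::real_inner, 'm) bmanifold_scheme"
  assumes M: "smooth_atlas M" and N: "smooth_atlas N"
  shows "smooth_map (prod_manifold M N) M fst"
proof -
  obtain B :: "'e set" where B: "finite B" "span B = UNIV" using smooth_atlas_finite_dim[OF M] .
  have "smooth_on (\<zeta> ` (Z \<inter> fst -` U')) (\<phi>' \<circ> fst \<circ> inv_into Z \<zeta>)"
    if "(Z, \<zeta>) \<in> charts (prod_manifold M N)" and U': "(U', \<phi>') \<in> charts M" for Z \<zeta> U' \<phi>'
  proof -
    from that(1) obtain U \<phi> V \<eta> where U: "(U, \<phi>) \<in> charts M" and V: "(V, \<eta>) \<in> charts N"
      and Z: "Z = U \<times> V" "\<zeta> = map_prod \<phi> \<eta>" unfolding charts_prod_manifold_iff by blast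
    have "smooth_on (\<zeta> ` (Z \<inter> fst -` U')) (\<lambda>z. (\<phi>' \<circ> inv_into U \<phi>) (fst z))"
      by (intro smooth_on_compose_fst[OF B smooth_atlas_transition[OF M U U']]) (auto simp: Z)
    then show ?thesis
      by (rule smooth_on_cong) (auto simp: Z chart_inv_into[OF M U]
          inv_into_map_prod[OF chart_inj_on[OF M U] chart_inj_on[OF N V]])
  qed
  moreover have "continuous_map (mtop (prod_manifold M N)) (mtop M) fst"
    by (simp add: mtop_prod_manifold continuous_map_fst)
  ultimately show ?thesis by (rule smooth_mapI[rotated])
qed

lemma smooth_map_snd:
  fixes N :: "('a, 'e::real_inner, 'm) bmanifold_scheme"
  assumes M: "smooth_atlas M" and N: "smooth_atlas N"
  shows "smooth_map (prod_manifold M N) N snd"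
proof -
  obtain B :: "'e set" where B: "finite B" "span B = UNIV" using smooth_atlas_finite_dim[OF N] .
  have "smooth_on (\<zeta> ` (Z \<inter> snd -` V')) (\<eta>' \<circ> snd \<circ> inv_into Z \<zeta>)"
    if "(Z, \<zeta>) \<in> charts (prod_manifold M N)" and V': "(V', \<eta>') \<in> charts N" for Z \<zeta> V' \<eta>'
  proof -
    from that(1) obtain U \<phi> V \<eta> where U: "(U, \<phi>) \<in> charts M" and V: "(V, \<eta>) \<in> charts N"
      and Z: "Z = U \<times> V" "\<zeta> = map_prod \<phi> \<eta>" unfolding charts_prod_manifold_iff by blast
    have "smooth_on (\<zeta> ` (Z \<inter> snd -` V')) (\<lambda>z. (\<eta>' \<circ> inv_into V \<eta>) (snd z))"
      by (intro smooth_on_compose_snd[OF B smooth_atlas_transition[OF N V V']]) (auto simp: Z)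
    then show ?thesis
      by (rule smooth_on_cong) (auto simp: Z chart_inv_into[OF N V]
          inv_into_map_prod[OF chart_inj_on[OF M U] chart_inj_on[OF N V]])
  qed
  moreover have "continuous_map (mtop (prod_manifold M N)) (mtop N) snd"
    by (simp add: mtop_prod_manifold continuous_map_snd)
  ultimately show ?thesis by (rule smooth_mapI[rotated])
qed

lemma smooth_map_Pair:
  assumes F: "smooth_map P M F" and G: "smooth_map P N G"
  shows "smooth_map P (prod_manifold M N) (\<lambda>x. (F x, G x))"
proof -
  have "smooth_on (\<kappa> ` (W \<inter> (\<lambda>x. (F x, G x)) -` Z)) (\<zeta> \<circ> (\<lambda>x. (F x, G x)) \<circ> inv_into W \<kappa>)"
    if W: "(W, \<kappa>) \<in> charts P" and "(Z, \<zeta>) \<in> charts (prod_manifold M N)" for W \<kappa> Z \<zeta>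
  proof -
    from that(2) obtain U \<phi> V \<eta> where U: "(U, \<phi>) \<in> charts M" and V: "(V, \<eta>) \<in> charts N"
      and Z: "Z = U \<times> V" "\<zeta> = map_prod \<phi> \<eta>" unfolding charts_prod_manifold_iff by blast
    have "smooth_on (\<kappa> ` (W \<inter> F -` U)) (\<phi> \<circ> F \<circ> inv_into W \<kappa>)"
      "smooth_on (\<kappa> ` (W \<inter> G -` V)) (\<eta> \<circ> G \<circ> inv_into W \<kappa>)"
      by (rule smooth_map_chart[OF F W U] smooth_map_chart[OF G W V])+
    then have "smooth_on (\<kappa> ` (W \<inter> (\<lambda>x. (F x, G x)) -` Z)) (\<phi> \<circ> F \<circ> inv_into W \<kappa>)"
      "smooth_on (\<kappa> ` (W \<inter> (\<lambda>x. (F x, G x)) -` Z)) (\<eta> \<circ> G \<circ> inv_into W \<kappa>)"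
      by (auto simp: Z intro: smooth_on_subset)
    from smooth_on_cong[OF smooth_on_Pair[OF this]] show ?thesis by (simp add: Z)
  qed
  moreover have "continuous_map (mtop P) (mtop (prod_manifold M N)) (\<lambda>x. (F x, G x))"
    unfolding mtop_prod_manifold using F G by (intro continuous_map_pairedI smooth_map_continuous)
  ultimately show ?thesis by (rule smooth_mapI[rotated])
qed

section \<open>Functions with values in a vector space\<close>

lemma smooth_atlas_vector_space:
  assumes "finite (B::'v::real_inner set)" "span B = UNIV"
  shows "smooth_atlas (vector_space_manifold :: ('v, 'v) bmanifold)"
proof -
  have "inv_into UNIV (id::'v \<Rightarrow> 'v) = id" by (simp add: fun_eq_iff inv_f_eq)
  moreover have "smooth_on UNIV (id::'v \<Rightarrow> 'v)"
    using smooth_on_bounded_linear[OF bounded_linear_ident] by (simp add: id_def)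
  ultimately show ?thesis
    by (intro smooth_atlasI[OF assms]) (simp_all add: vector_space_manifold_def)
qed

text \<open>A smooth local extension in one chart around each point is enough: it gives continuity,
  and the transition maps carry smoothness to every other chart. Functions built patch by patch are
  shown to be smooth in this way.\<close>

lemma smooth_map_vector_spaceI:
  fixes M :: "('a, 'e::real_inner, 'm) bmanifold_scheme"
  assumes M: "smooth_atlas M"
    and loc: "\<And>p. p \<in> topspace (mtop M) \<Longrightarrow> \<exists>U \<phi> T q. (U, \<phi>) \<in> charts M \<and> p \<in> U \<and>
      open T \<and> \<phi> p \<in> T \<and> (\<forall>k. Ck_on k q T) \<and> (\<forall>x\<in>U. \<phi> x \<in> T \<longrightarrow> f x = q (\<phi> x))"
  shows "smooth_map M vector_space_manifold f"
proof -
  obtain B :: "'e set" where B: "finite B" "span B = UNIV" using smooth_atlas_finite_dim[OF M] .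
  have "openin (mtop M) {x \<in> topspace (mtop M). f x \<in> V}" if "open V" for V
  proof (subst openin_subopen, rule ballI)
    fix p assume p: "p \<in> {x \<in> topspace (mtop M). f x \<in> V}"
    with loc[of p] obtain U \<phi> T q where U: "(U, \<phi>) \<in> charts M" "p \<in> U"
      and T: "open T" "\<phi> p \<in> T" "\<And>k. Ck_on k q T" "\<And>x. x \<in> U \<Longrightarrow> \<phi> x \<in> T \<Longrightarrow> f x = q (\<phi> x)"
      by blast
    have "open (T \<inter> q -` V)"
      using continuous_open_preimage[OF Ck_on_imp_continuous_on[OF T(3)[of 0]] T(1) \<open>open V\<close>] .
    from chart_openin_vimage[OF M U(1) this] show "\<exists>S. openin (mtop M) S \<and> p \<in> S \<and>
        S \<subseteq> {x \<in> topspace (mtop M). f x \<in> V}"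
      using U p T chart_subset[OF M U(1)]
      by (intro exI[of _ "{x \<in> U. \<phi> x \<in> T \<inter> q -` V}"] conjI) auto
  qed
  then have "continuous_map (mtop M) euclidean f"
    unfolding continuous_map_def by auto
  \<comment> \<open>In an arbitrary chart, the extension \<open>q\<close> is pulled back along the
    transition map.\<close>
  moreover have "smooth_on (\<phi> ` U) (f \<circ> inv_into U \<phi>)" if U: "(U, \<phi>) \<in> charts M" for U \<phi>
  proof (rule smooth_on_local)
    fix x assume "x \<in> \<phi> ` U"
    then obtain p where p: "p \<in> U" "x = \<phi> p" by auto
    then have "p \<in> topspace (mtop M)" using chart_subset[OF M U] by auto
    with loc[of p] obtain V \<eta> T q where V: "(V, \<eta>) \<in> charts M" "p \<in> V"
      and T: "open T" "\<eta> p \<in> T" "\<And>k. Ck_on k q T" "\<And>x. x \<in> V \<Longrightarrow> \<eta> x \<in> T \<Longrightarrow> f x = q (\<eta> x)"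
      by blast
    obtain S where S: "open S" "\<phi> ` (U \<inter> {x \<in> V. \<eta> x \<in> T}) = \<phi> ` U \<inter> S"
      using chart_open_image[OF M U chart_openin_vimage[OF M V(1) T(1)]] .
    have 1: "smooth_on (\<phi> ` U \<inter> S) (\<eta> \<circ> inv_into U \<phi>)"
      by (rule smooth_on_subset[OF smooth_atlas_transition[OF M U V(1)]]) (use S(2) in blast)
    have "smooth_on (\<phi> ` U \<inter> S) (\<lambda>x. q ((\<eta> \<circ> inv_into U \<phi>) x))"
      by (rule smooth_on_compose[OF B 1 Ck_on_imp_smooth_on[OF T(1,3)]])
        (auto simp: S(2)[symmetric] chart_inv_into[OF M U])
    then have "smooth_on (\<phi> ` U \<inter> S) (f \<circ> inv_into U \<phi>)"
      by (rule smooth_on_cong) (auto simp: S(2)[symmetric] chart_inv_into[OF M U] T)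
    moreover have "x \<in> S" using S(2) p V(2) T(2) by blast
    ultimately show "\<exists>T. open T \<and> x \<in> T \<and> smooth_on (\<phi> ` U \<inter> T) (f \<circ> inv_into U \<phi>)"
      using S(1) by blast
  qed
  ultimately show ?thesis
    by (intro smooth_mapI) (auto simp: vector_space_manifold_def)
qed

lemma smooth_map_vector_spaceD:
  assumes M: "smooth_atlas M" and f: "smooth_map M vector_space_manifold f"
    and U: "(U, \<phi>) \<in> charts M" "p \<in> U"
  obtains T q where "open T" "\<phi> p \<in> T" "\<And>k. Ck_on k q T" "\<And>x. x \<in> U \<Longrightarrow> \<phi> x \<in> T \<Longrightarrow> q (\<phi> x) = f x"
proof -
  have "smooth_on (\<phi> ` U) (f \<circ> inv_into U \<phi>)"
    using smooth_map_chart[OF f U(1), of UNIV id] by (simp add: vector_space_manifold_def)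
  then obtain T q where T: "open T" "\<phi> p \<in> T" "\<And>k. Ck_on k q T"
    "\<And>y. y \<in> \<phi> ` U \<Longrightarrow> y \<in> T \<Longrightarrow> q y = (f \<circ> inv_into U \<phi>) y"
    by (rule smooth_onE[OF _ imageI[OF U(2)]]) blast
  show thesis
    by (rule that[OF T(1-3)]) (simp add: T(4) chart_inv_into[OF M U(1)])
qed

text \<open>Stated for general bilinear maps to serve both the product of two real functions and the
  scaling of a complex variable by a real function.\<close>

lemma smooth_map_bilinear:
  assumes M: "smooth_atlas M" and f: "smooth_map M vector_space_manifold f"
    and g: "smooth_map M vector_space_manifold g" and B: "bounded_bilinear B"
  shows "smooth_map M vector_space_manifold (\<lambda>x. B (f x) (g x))"
proof (rule smooth_map_vector_spaceI[OF M])
  fix p assume "p \<in> topspace (mtop M)"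
  then obtain U \<phi> where U: "(U, \<phi>) \<in> charts M" "p \<in> U" using smooth_atlas_chart_at[OF M] by metis
  obtain T q where T: "open T" "\<phi> p \<in> T" "\<And>k. Ck_on k q T" "\<And>x. x \<in> U \<Longrightarrow> \<phi> x \<in> T \<Longrightarrow> q (\<phi> x) = f x"
    by (rule smooth_map_vector_spaceD[OF M f U]) blast
  obtain T' q' where T': "open T'" "\<phi> p \<in> T'" "\<And>k. Ck_on k q' T'"
    "\<And>x. x \<in> U \<Longrightarrow> \<phi> x \<in> T' \<Longrightarrow> q' (\<phi> x) = g x"
    by (rule smooth_map_vector_spaceD[OF M g U]) blast
  have "Ck_on k (\<lambda>x. B (q x) (q' x)) (T \<inter> T')" for k
    using T(1,3) T'(1,3) by (intro Ck_on_bilinear[OF B] open_Int) (auto intro: Ck_on_subset)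
  with T T' U show "\<exists>U \<phi> T q. (U, \<phi>) \<in> charts M \<and> p \<in> U \<and> open T \<and> \<phi> p \<in> T \<and>
      (\<forall>k. Ck_on k q T) \<and> (\<forall>x\<in>U. \<phi> x \<in> T \<longrightarrow> B (f x) (g x) = q (\<phi> x))"
    by (intro exI[of _ U] exI[of _ \<phi>] exI[of _ "T \<inter> T'"] exI[of _ "\<lambda>x. B (q x) (q' x)"]) auto
qed

lemma finite_span_real: "finite {1::real}" "span {1::real} = UNIV"
  using span_Basis[where 'a = real] by auto

lemma smooth_map_powr:
  assumes M: "smooth_atlas M" and f: "smooth_real_function M f"
    and pos: "\<And>x. x \<in> topspace (mtop M) \<Longrightarrow> f x > 0"
  shows "smooth_real_function M (\<lambda>x. f x powr a)"
proof (rule smooth_map_vector_spaceI[OF M])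
  fix p assume p: "p \<in> topspace (mtop M)"
  then obtain U \<phi> where U: "(U, \<phi>) \<in> charts M" "p \<in> U" using smooth_atlas_chart_at[OF M] by metis
  obtain T q where T: "open T" "\<phi> p \<in> T" "\<And>k. Ck_on k q T" "\<And>x. x \<in> U \<Longrightarrow> \<phi> x \<in> T \<Longrightarrow> q (\<phi> x) = f x"
    by (rule smooth_map_vector_spaceD[OF M f U]) blast
  \<comment> \<open>The extension \<open>q\<close> is known to be positive only on the image of the
    chart, so its domain is shrunk to where it is positive.\<close>
  let ?T = "T \<inter> q -` {0<..}"
  have "open ?T"
    using continuous_open_preimage[OF Ck_on_imp_continuous_on[OF T(3)[of 0]] T(1) open_greaterThan] .
  moreover have "Ck_on k (\<lambda>x. q x powr a) ?T" for k
    using \<open>open ?T\<close> by (rule Ck_on_compose[OF finite_span_real _ Ck_on_subset[OF T(3)] Ck_on_powr]) auto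
  ultimately show "\<exists>U \<phi> T q. (U, \<phi>) \<in> charts M \<and> p \<in> U \<and> open T \<and> \<phi> p \<in> T \<and>
      (\<forall>k. Ck_on k q T) \<and> (\<forall>x\<in>U. \<phi> x \<in> T \<longrightarrow> f x powr a = q (\<phi> x))"
    using T U p pos
    by (intro exI[of _ U] exI[of _ \<phi>] exI[of _ ?T] exI[of _ "\<lambda>x. q x powr a"]) auto
qed

section \<open>Boundary defining functions and invariant neighbourhoods\<close>

text \<open>For a boundary point \<open>p\<close> and normal \<open>b\<close>, this moves from the
  hyperplane into the open half-space without leaving a given open set.\<close>

lemma open_ray_point:
  fixes p b :: "'a::real_normed_vector"
  assumes "open S" "p \<in> S"
  obtains t where "t > 0" "p + t *\<^sub>R b \<in> S"
proof -
  have "open ((\<lambda>t. p + t *\<^sub>R b) -` S)"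
    by (intro open_vimage assms continuous_intros)
  moreover have "0 \<in> (\<lambda>t. p + t *\<^sub>R b) -` S" using assms by simp
  ultimately obtain e where e: "e > 0" "ball 0 e \<subseteq> (\<lambda>t. p + t *\<^sub>R b) -` S"
    by (meson openE)
  have "e / 2 \<in> ball 0 e" using e(1) by simp
  with e(2) have "p + (e / 2) *\<^sub>R b \<in> S" by blast
  with e(1) that[of "e / 2"] show thesis by simp
qed

section \<open>Boundary charts and the local form of boundary defining functions\<close>

lemma mboundary_chart:
  assumes "p \<in> mboundary M"
  obtains U \<phi> b where "(U, \<phi>) \<in> charts M" "p \<in> U" "b \<noteq> 0"
    "openin (top_of_set (halfspace b)) (\<phi> ` U)" "b \<bullet> \<phi> p = 0"
  using assms unfolding mboundary_def by blast

lemma mboundary_chartI: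
  assumes "(U, \<phi>) \<in> charts M" "p \<in> U" "b \<noteq> 0"
    "openin (top_of_set (halfspace b)) (\<phi> ` U)" "b \<bullet> \<phi> p = 0"
  shows "p \<in> mboundary M"
  using assms unfolding mboundary_def by blast

lemma
  assumes "invariant_boundary_defining_function M f"
  shows bdf_smooth: "smooth_real_function M f"
    and bdf_nonneg: "x \<in> topspace (mtop M) \<Longrightarrow> 0 \<le> f x"
    and bdf_zero_iff: "x \<in> topspace (mtop M) \<Longrightarrow> f x = 0 \<longleftrightarrow> x \<in> mboundary M"
    and bdf_mboundary_subset: "mboundary M \<subseteq> topspace (mtop M)"
    and bdf_differential: "x \<in> mboundary M \<Longrightarrow> \<not> differential_vanishes_at M f x"
  using assms unfolding invariant_boundary_defining_function_def by blast+

lemma differential_vanishes_atI: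
  assumes "(U, \<phi>) \<in> charts M" "p \<in> U"
    "((f \<circ> inv_into U \<phi>) has_derivative (\<lambda>v. 0)) (at (\<phi> p) within \<phi> ` U)"
  shows "differential_vanishes_at M f p"
  using assms unfolding differential_vanishes_at_def by blast

text \<open>Invariance of the boundary under a change of charts comes for free here: at a point of
  \<open>mboundary M\<close> that some chart maps into the open half-space, the boundary defining function
  would have an interior minimum and hence a vanishing differential.\<close>

lemma mboundary_chart_iff:
  assumes M: "smooth_atlas M" and f: "invariant_boundary_defining_function M f"
    and U: "(U, \<phi>) \<in> charts M" and b: "b \<noteq> 0" "openin (top_of_set (halfspace b)) (\<phi> ` U)"
    and y: "y \<in> U"
  shows "y \<in> mboundary M \<longleftrightarrow> b \<bullet> \<phi> y = 0"
proof
  show "y \<in> mboundary M" if "b \<bullet> \<phi> y = 0"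
    using mboundary_chartI[OF U y b that] .
  show "b \<bullet> \<phi> y = 0" if bd: "y \<in> mboundary M"
  proof (rule ccontr)
    assume "b \<bullet> \<phi> y \<noteq> 0"
    obtain S where S: "open S" "\<phi> ` U = halfspace b \<inter> S"
      using b(2) by (auto simp: openin_open)
    have "\<phi> y \<in> halfspace b" using S(2) y by blast
    with \<open>b \<bullet> \<phi> y \<noteq> 0\<close> have pos: "b \<bullet> \<phi> y > 0" by (simp add: halfspace_def)
    obtain T q where T: "open T" "\<phi> y \<in> T" "\<And>k. Ck_on k q T" "\<And>x. x \<in> U \<Longrightarrow> \<phi> x \<in> T \<Longrightarrow> q (\<phi> x) = f x"
      by (rule smooth_map_vector_spaceD[OF M bdf_smooth[OF f] U y]) blast
    \<comment> \<open>An open subset of the chart image, so the extension \<open>q\<close> is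
      nonnegative on all sides of its zero \<open>\<phi> y\<close>.\<close>
    let ?S = "T \<inter> S \<inter> {x. 0 < b \<bullet> x}"
    have "open ?S" using T(1) S(1) by (intro open_Int open_halfspace_gt)
    have in_S: "\<phi> y \<in> ?S" using T(2) S(2) y pos by blast
    have eq: "\<exists>z\<in>U. x = \<phi> z \<and> q x = f z" if "x \<in> ?S" for x
    proof -
      have "x \<in> \<phi> ` U" using that S(2) by (auto simp: halfspace_def)
      with that T(4) show ?thesis by blast
    qed
    have der: "(q has_derivative frechet_derivative q (at (\<phi> y))) (at (\<phi> y))"
      by (rule Ck_on_Suc_has_derivative[OF T(3)[of "Suc 0"] T(2)])
    have "f y = 0" using bdf_zero_iff[OF f] bdf_mboundary_subset[OF f] bd by blast
    then have "q (\<phi> y) = 0" using T(2,4) y by simp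
    moreover have "0 \<le> q x" if "x \<in> ?S" for x
      using eq[OF that] bdf_nonneg[OF f] chart_subset[OF M U] by auto
    ultimately have "frechet_derivative q (at (\<phi> y)) = (\<lambda>v. 0)"
      using differential_zero_maxmin[OF in_S \<open>open ?S\<close> der] by simp
    with der have "(q has_derivative (\<lambda>v. 0)) (at (\<phi> y))" by simp
    then have "((f \<circ> inv_into U \<phi>) has_derivative (\<lambda>v. 0)) (at (\<phi> y))"
    proof (rule has_derivative_transform_within_open[OF _ \<open>open ?S\<close> in_S])
      show "q x = (f \<circ> inv_into U \<phi>) x" if "x \<in> ?S" for x
        using eq[OF that] chart_inv_into[OF M U] by auto
    qed
    then have "differential_vanishes_at M f y"
      by (rule differential_vanishes_atI[OF U y has_derivative_at_withinI])
    then show False using bdf_differential[OF f bd] by simp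
  qed
qed

text \<open>A smooth extension of \<open>f\<close> vanishes on the hyperplane, so Hadamard's lemma
  splits off the factor \<open>b \<bullet> x\<close>. The cofactor is nonnegative at
  \<open>\<phi> p\<close> because \<open>f\<close> is nonnegative inside, and nonzero because the
  differential of \<open>f\<close> at \<open>p\<close> is \<open>G (\<phi> p)\<close> times the
  functional \<open>b\<close>. Positivity then persists nearby.\<close>

lemma bdf_local_form:
  fixes M :: "('a, 'e::real_inner, 'm) circle_bmanifold_scheme"
  assumes M: "smooth_atlas M" and f: "invariant_boundary_defining_function M f"
    and U: "(U, \<phi>) \<in> charts M" and b: "b \<noteq> 0" "openin (top_of_set (halfspace b)) (\<phi> ` U)"
    and p: "p \<in> U" "b \<bullet> \<phi> p = 0"
  obtains T G where "open T" "\<phi> p \<in> T" "\<And>k. Ck_on k G T" "\<And>x. x \<in> T \<Longrightarrow> G x > 0"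
    "\<And>y. y \<in> U \<Longrightarrow> \<phi> y \<in> T \<Longrightarrow> f y = (b \<bullet> \<phi> y) * G (\<phi> y)"
proof -
  obtain B :: "'e set" where B: "finite B" "span B = UNIV" using smooth_atlas_finite_dim[OF M] .
  obtain S where S: "open S" "\<phi> ` U = halfspace b \<inter> S"
    using b(2) by (auto simp: openin_open)
  obtain T F where T: "open T" "\<phi> p \<in> T" "\<And>k. Ck_on k F T" "\<And>x. x \<in> U \<Longrightarrow> \<phi> x \<in> T \<Longrightarrow> F (\<phi> x) = f x"
    by (rule smooth_map_vector_spaceD[OF M bdf_smooth[OF f] U p(1)]) blast
  have "open (T \<inter> S)" "\<phi> p \<in> T \<inter> S" using T S p(1) by (blast intro: open_Int)+
  then obtain r where r: "r > 0" "ball (\<phi> p) r \<subseteq> T \<inter> S" by (meson openE)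
  let ?B = "ball (\<phi> p) r"
  \<comment> \<open>Only points on the half-space side come from the manifold; beyond it the values
    of \<open>F\<close> are arbitrary.\<close>
  have U_point: "\<exists>y\<in>U. x = \<phi> y \<and> F x = f y" if x: "x \<in> ?B" "b \<bullet> x \<ge> 0" for x
  proof -
    have "x \<in> \<phi> ` U" using S(2) x r(2) by (auto simp: halfspace_def)
    with T(4) x r(2) show ?thesis by blast
  qed
  have zero: "F x = 0" if x: "x \<in> ?B" "b \<bullet> x = 0" for x
  proof -
    obtain y where y: "y \<in> U" "x = \<phi> y" "F x = f y" using U_point[OF x(1)] x(2) by auto
    then have "y \<in> mboundary M" using mboundary_chart_iff[OF M f U b y(1)] x(2) by simp
    then have "f y = 0" using bdf_zero_iff[OF f] bdf_mboundary_subset[OF f] by blast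
    with y show ?thesis by simp
  qed
  have ckF: "Ck_on k F ?B" for k using T(3) r(2) by (blast intro: Ck_on_subset)
  obtain G where G: "\<And>k. Ck_on k G ?B" "\<And>x. x \<in> ?B \<Longrightarrow> F x = (b \<bullet> x) * G x"
    using hadamard_hyperplane[OF B b(1) p(2) ckF zero] by blast
  have contG: "open {x \<in> ?B. G x \<in> V}" if "open V" for V
    using continuous_open_preimage[OF Ck_on_imp_continuous_on[OF G(1)[of 0]] open_ball that]
    by (simp add: vimage_def Int_def)
  have in_B: "\<phi> p \<in> ?B" using r(1) by simp
  \<comment> \<open>A negative value would persist a little way along \<open>b\<close>, where
    \<open>b \<bullet> x > 0\<close>, and make \<open>f\<close> negative there.\<close>
  have "\<not> G (\<phi> p) < 0"
  proof
    assume "G (\<phi> p) < 0"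
    with in_B have "\<phi> p \<in> {x \<in> ?B. G x \<in> {..<0}}" by simp
    from open_ray_point[OF contG[OF open_lessThan] this, of b]
    obtain t where t: "t > 0" "\<phi> p + t *\<^sub>R b \<in> ?B" "G (\<phi> p + t *\<^sub>R b) < 0" by auto
    have pos: "b \<bullet> (\<phi> p + t *\<^sub>R b) > 0" using t(1) p(2) b(1) by (simp add: inner_add_right)
    then obtain y where "y \<in> U" "F (\<phi> p + t *\<^sub>R b) = f y" using U_point[OF t(2)] by auto
    then have "F (\<phi> p + t *\<^sub>R b) \<ge> 0" using bdf_nonneg[OF f] chart_subset[OF M U] by auto
    then show False using G(2)[OF t(2)] mult_pos_neg[OF pos t(3)] by simp
  qed
  moreover have "G (\<phi> p) \<noteq> 0"
  proof
    assume G0: "G (\<phi> p) = 0"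
    \<comment> \<open>Product rule: the first term dies since
      \<open>b \<bullet> \<phi> p = 0\<close>, the second by \<open>G0\<close>, so the differential
      of \<open>f\<close> would vanish.\<close>
    have "((\<lambda>x. (b \<bullet> x) * G x) has_derivative
        (\<lambda>v. (b \<bullet> \<phi> p) * frechet_derivative G (at (\<phi> p)) v + (b \<bullet> v) * G (\<phi> p))) (at (\<phi> p))"
      by (rule has_derivative_mult[OF has_derivative_inner_right[OF has_derivative_ident]
          Ck_on_Suc_has_derivative[OF G(1)[of "Suc 0"] in_B]])
    then have "((\<lambda>x. (b \<bullet> x) * G x) has_derivative (\<lambda>v. 0)) (at (\<phi> p) within \<phi> ` U)"
      using G0 p(2) by (simp add: has_derivative_at_withinI)
    then have "((f \<circ> inv_into U \<phi>) has_derivative (\<lambda>v. 0)) (at (\<phi> p) within \<phi> ` U)"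
    proof (rule has_derivative_transform_within[OF _ r(1)])
      show "(b \<bullet> x) * G x = (f \<circ> inv_into U \<phi>) x" if x: "x \<in> \<phi> ` U" "dist x (\<phi> p) < r" for x
      proof -
        from x(1) obtain y where y: "y \<in> U" "x = \<phi> y" by blast
        have xB: "x \<in> ?B" using x(2) by (simp add: dist_commute)
        have "F x = f y" using T(4)[OF y(1)] xB r(2) y(2) by auto
        then show ?thesis using G(2)[OF xB] y chart_inv_into[OF M U] by simp
      qed
    qed (use p in blast)
    then have "differential_vanishes_at M f p" by (rule differential_vanishes_atI[OF U p(1)])
    moreover have "p \<in> mboundary M" using mboundary_chart_iff[OF M f U b p(1)] p(2) by simp
    ultimately show False using bdf_differential[OF f] by blast
  qed
  ultimately have "G (\<phi> p) > 0" by simp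
  let ?T = "{x \<in> ?B. G x \<in> {0<..}}"
  show thesis
  proof (rule that)
    show "open ?T" by (rule contG[OF open_greaterThan])
    show "\<phi> p \<in> ?T" using in_B \<open>G (\<phi> p) > 0\<close> by simp
    show "Ck_on k G ?T" for k by (rule Ck_on_subset[OF G(1)]) blast
    show "G x > 0" if "x \<in> ?T" for x using that by simp
    show "f y = (b \<bullet> \<phi> y) * G (\<phi> y)" if "y \<in> U" "\<phi> y \<in> ?T" for y
    proof -
      have yB: "\<phi> y \<in> ?B" using that(2) by simp
      then have "\<phi> y \<in> T" using r(2) by blast
      from T(4)[OF that(1) this] G(2)[OF yB] show ?thesis by simp
    qed
  qed
qed

text \<open>The boundary has empty interior: from a boundary point, a small move along the inward
  normal \<open>b\<close> stays in \<open>W\<close> and leaves the hyperplane.\<close>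

lemma interior_point_nearby:
  assumes M: "smooth_atlas M" and f: "invariant_boundary_defining_function M f"
    and W: "openin (mtop M) W" "p \<in> W"
  obtains y where "y \<in> W" "y \<notin> mboundary M"
proof (cases "p \<in> mboundary M")
  case True
  then obtain U \<phi> b where U: "(U, \<phi>) \<in> charts M" "p \<in> U" and b: "b \<noteq> 0"
    "openin (top_of_set (halfspace b)) (\<phi> ` U)" and bp: "b \<bullet> \<phi> p = 0"
    by (rule mboundary_chart)
  obtain S where S: "open S" "\<phi> ` U = halfspace b \<inter> S"
    using b(2) by (auto simp: openin_open)
  obtain T where T: "open T" "\<phi> ` (U \<inter> W) = \<phi> ` U \<inter> T"
    using chart_open_image[OF M U(1) W(1)] .
  have "open (S \<inter> T)" "\<phi> p \<in> S \<inter> T" using S T U(2) W(2) by (blast intro: open_Int)+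
  then obtain t where t: "t > 0" "\<phi> p + t *\<^sub>R b \<in> S \<inter> T" by (rule open_ray_point)
  have pos: "b \<bullet> (\<phi> p + t *\<^sub>R b) > 0" using t(1) bp b(1) by (simp add: inner_add_right)
  then have "\<phi> p + t *\<^sub>R b \<in> \<phi> ` (U \<inter> W)"
    unfolding T(2) S(2) using t(2) by (simp add: halfspace_def)
  then obtain y where y: "y \<in> U" "y \<in> W" "\<phi> y = \<phi> p + t *\<^sub>R b" by force
  then have "y \<notin> mboundary M" using mboundary_chart_iff[OF M f U(1) b y(1)] pos by simp
  with y that show thesis by blast
next
  case False
  with W(2) show thesis by (rule that)
qed

text \<open>The density argument in the form needed twice: to match local quotients on overlaps of
  patches, and to extend invariance of \<open>g\<close> to the boundary.\<close>

lemma continuous_eq_off_mboundary: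
  fixes g\<^sub>1 g\<^sub>2 :: "'a \<Rightarrow> real"
  assumes M: "smooth_atlas M" and f: "invariant_boundary_defining_function M f"
    and W: "openin (mtop M) W" and cont: "continuous_map (subtopology (mtop M) W) euclidean g\<^sub>1"
      "continuous_map (subtopology (mtop M) W) euclidean g\<^sub>2"
    and eq: "\<And>y. y \<in> W \<Longrightarrow> y \<notin> mboundary M \<Longrightarrow> g\<^sub>1 y = g\<^sub>2 y" and x: "x \<in> W"
  shows "g\<^sub>1 x = g\<^sub>2 x"
proof (rule ccontr)
  assume ne: "g\<^sub>1 x \<noteq> g\<^sub>2 x"
  let ?Z = "{y \<in> topspace (subtopology (mtop M) W). g\<^sub>1 y - g\<^sub>2 y \<in> - {0}}"
  have "openin euclidean (- {0::real})" unfolding open_openin[symmetric] by (rule open_Compl) simp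
  with continuous_map_diff[OF cont] have "openin (subtopology (mtop M) W) ?Z"
    by (rule openin_continuous_map_preimage)
  then have Z: "openin (mtop M) ?Z"
    using W by (rule openin_trans_full)
  have "x \<in> ?Z" using x ne openin_subset[OF W] by auto
  obtain y where y: "y \<in> ?Z" "y \<notin> mboundary M"
    using interior_point_nearby[OF M f Z \<open>x \<in> ?Z\<close>] .
  then have "y \<in> W" "g\<^sub>1 y \<noteq> g\<^sub>2 y" by simp_all
  from \<open>g\<^sub>1 y \<noteq> g\<^sub>2 y\<close> eq[OF \<open>y \<in> W\<close> y(2)] show False by (rule notE)
qed

text \<open>Both functions are written with a common factor \<open>c\<close> and positive smooth
  cofactors, so that the quotient of the cofactors works even where \<open>c = 0\<close>. At a
  boundary point \<open>c\<close> is \<open>b \<bullet> \<phi> y\<close>, the same for both because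
  one chart and one \<open>b\<close> are used; at an interior point \<open>c = 1\<close>.\<close>

lemma bdf_ratio_local:
  assumes M: "smooth_atlas M" and f: "invariant_boundary_defining_function M f"
    and f': "invariant_boundary_defining_function M f'" and p: "p \<in> topspace (mtop M)"
  shows "\<exists>U \<phi> T q. (U, \<phi>) \<in> charts M \<and> p \<in> U \<and> open T \<and> \<phi> p \<in> T \<and> (\<forall>k. Ck_on k q T) \<and>
    (\<forall>x\<in>T. q x > (0::real)) \<and> (\<forall>y\<in>U. \<phi> y \<in> T \<longrightarrow> f y = q (\<phi> y) * f' y)"
proof -
  have "\<exists>U \<phi> T G G'. (U, \<phi>) \<in> charts M \<and> p \<in> U \<and> open T \<and> \<phi> p \<in> T \<and> (\<forall>k. Ck_on k G T) \<and>
      (\<forall>k. Ck_on k G' T) \<and> (\<forall>x\<in>T. G x > (0::real)) \<and> (\<forall>x\<in>T. G' x > (0::real)) \<and>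
      (\<forall>y\<in>U. \<phi> y \<in> T \<longrightarrow> (\<exists>c. f y = c * G (\<phi> y) \<and> f' y = c * G' (\<phi> y)))"
  proof (cases "p \<in> mboundary M")
    case True
    then obtain U \<phi> b where U: "(U, \<phi>) \<in> charts M" and p: "p \<in> U" and b: "b \<noteq> 0"
      "openin (top_of_set (halfspace b)) (\<phi> ` U)" and bp: "b \<bullet> \<phi> p = 0"
      by (rule mboundary_chart)
    obtain T G where T: "open T" "\<phi> p \<in> T" "\<And>k. Ck_on k G T" "\<And>x. x \<in> T \<Longrightarrow> G x > 0"
      "\<And>y. y \<in> U \<Longrightarrow> \<phi> y \<in> T \<Longrightarrow> f y = (b \<bullet> \<phi> y) * G (\<phi> y)"
      by (rule bdf_local_form[OF M f U b p bp]) blast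
    obtain T' G' where T': "open T'" "\<phi> p \<in> T'" "\<And>k. Ck_on k G' T'" "\<And>x. x \<in> T' \<Longrightarrow> G' x > 0"
      "\<And>y. y \<in> U \<Longrightarrow> \<phi> y \<in> T' \<Longrightarrow> f' y = (b \<bullet> \<phi> y) * G' (\<phi> y)"
      by (rule bdf_local_form[OF M f' U b p bp]) blast
    have "Ck_on k G (T \<inter> T')" for k by (rule Ck_on_subset[OF T(3)]) simp
    moreover have "Ck_on k G' (T \<inter> T')" for k by (rule Ck_on_subset[OF T'(3)]) simp
    moreover have "\<exists>c. f y = c * G (\<phi> y) \<and> f' y = c * G' (\<phi> y)" if "y \<in> U" "\<phi> y \<in> T \<inter> T'" for y
      using T(5)[of y] T'(5)[of y] that by blast
    moreover have "open (T \<inter> T')" using T(1) T'(1) by (rule open_Int)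
    ultimately show ?thesis
      using U p T(2,4) T'(2,4)
      by (intro exI[of _ U] exI[of _ \<phi>] exI[of _ "T \<inter> T'"] exI[of _ G] exI[of _ G']) simp
  next
    case False
    then have pos: "f p > 0" "f' p > 0"
      using bdf_zero_iff[OF f p] bdf_zero_iff[OF f' p] bdf_nonneg[OF f p] bdf_nonneg[OF f' p] by auto
    obtain U \<phi> where U: "(U, \<phi>) \<in> charts M" "p \<in> U" using smooth_atlas_chart_at[OF M p] .
    obtain T G where T: "open T" "\<phi> p \<in> T" "\<And>k. Ck_on k G T" "\<And>y. y \<in> U \<Longrightarrow> \<phi> y \<in> T \<Longrightarrow> G (\<phi> y) = f y"
      by (rule smooth_map_vector_spaceD[OF M bdf_smooth[OF f] U]) blast
    obtain T' G' where T': "open T'" "\<phi> p \<in> T'" "\<And>k. Ck_on k G' T'"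
      "\<And>y. y \<in> U \<Longrightarrow> \<phi> y \<in> T' \<Longrightarrow> G' (\<phi> y) = f' y"
      by (rule smooth_map_vector_spaceD[OF M bdf_smooth[OF f'] U]) blast
    define S where "S = (T \<inter> G -` {0<..}) \<inter> (T' \<inter> G' -` {0<..})"
    have "open S" unfolding S_def
      using continuous_open_preimage[OF Ck_on_imp_continuous_on[OF T(3)[of 0]] T(1) open_greaterThan]
        continuous_open_preimage[OF Ck_on_imp_continuous_on[OF T'(3)[of 0]] T'(1) open_greaterThan]
      by (rule open_Int)
    moreover have "Ck_on k G S" for k
      by (rule Ck_on_subset[OF T(3)]) (auto simp: S_def)
    moreover have "Ck_on k G' S" for k
      by (rule Ck_on_subset[OF T'(3)]) (auto simp: S_def)
    moreover have "\<exists>c. f y = c * G (\<phi> y) \<and> f' y = c * G' (\<phi> y)" if "y \<in> U" "\<phi> y \<in> S" for y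
      using T(4)[OF that(1)] T'(4)[OF that(1)] that(2) by (intro exI[of _ 1]) (simp add: S_def)
    moreover have "\<phi> p \<in> S" "\<And>x. x \<in> S \<Longrightarrow> G x > 0" "\<And>x. x \<in> S \<Longrightarrow> G' x > 0"
      using U T(2,4) T'(2,4) pos by (simp_all add: S_def)
    ultimately show ?thesis
      using U by (intro exI[of _ U] exI[of _ \<phi>] exI[of _ S] exI[of _ G] exI[of _ G'] conjI allI ballI impI)
  qed
  then obtain U \<phi> T G G' where U: "(U, \<phi>) \<in> charts M" "p \<in> U" and T: "open T" "\<phi> p \<in> T"
    "\<And>k. Ck_on k G T" "\<And>k. Ck_on k G' T" "\<And>x. x \<in> T \<Longrightarrow> G x > (0::real)" "\<And>x. x \<in> T \<Longrightarrow> G' x > (0::real)"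
    "\<And>y. y \<in> U \<Longrightarrow> \<phi> y \<in> T \<Longrightarrow> \<exists>c. f y = c * G (\<phi> y) \<and> f' y = c * G' (\<phi> y)"
    by blast
  let ?q = "\<lambda>x. G x * G' x powr (- 1)"
  have "Ck_on k (\<lambda>x. G' x powr (- 1)) T" for k
    by (rule Ck_on_compose[OF finite_span_real T(1) T(4) Ck_on_powr]) (use T(6) in auto)
  then have "Ck_on k ?q T" for k
    by (rule Ck_on_bilinear[OF bounded_bilinear_mult T(1) T(3)])
  moreover have "f y = ?q (\<phi> y) * f' y" if y: "y \<in> U" "\<phi> y \<in> T" for y
  proof -
    obtain c where "f y = c * G (\<phi> y)" "f' y = c * G' (\<phi> y)" using T(7)[OF y] by blast
    with T(6)[OF y(2)] show ?thesis by (simp add: powr_minus)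
  qed
  moreover have "?q x > 0" if "x \<in> T" for x
    using T(5,6)[OF that] by simp
  ultimately show ?thesis
    using U T(1,2) by (intro exI[of _ U] exI[of _ \<phi>] exI[of _ T] exI[of _ ?q]) simp
qed

lemma chart_compose_continuous:
  assumes M: "smooth_atlas M" and U: "(U, \<phi>) \<in> charts M" and q: "continuous_on T q"
    and W: "W \<subseteq> {x \<in> U. \<phi> x \<in> T}"
  shows "continuous_map (subtopology (mtop M) W) euclidean (\<lambda>x. q (\<phi> x))"
proof -
  have "continuous_map (subtopology (mtop M) U) euclidean \<phi>"
    using homeomorphic_imp_continuous_map[OF chart_homeomorphic[OF M U]]
    by (simp add: continuous_map_in_subtopology)
  then have "continuous_map (subtopology (mtop M) W) euclidean \<phi>"
    by (rule continuous_map_from_subtopology_mono) (use W in auto)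
  then have "continuous_map (subtopology (mtop M) W) (top_of_set T) \<phi>"
    using W by (auto simp: continuous_map_in_subtopology)
  from continuous_map_compose[OF this, of euclidean q] q show ?thesis by (simp add: o_def)
qed

text \<open>Off the boundary every local quotient equals \<open>f / f'\<close>; two of them
  therefore agree on the overlap of their patches, boundary points included, by continuity and
  density.\<close>

lemma bdf_ratio:
  assumes M: "smooth_atlas M" and f: "invariant_boundary_defining_function M f"
    and f': "invariant_boundary_defining_function M f'"
  obtains r where "smooth_real_function M r" "\<And>x. x \<in> topspace (mtop M) \<Longrightarrow> r x > 0"
    "\<And>x. x \<in> topspace (mtop M) \<Longrightarrow> f x = r x * f' x"
proof -
  \<comment> \<open>The implication sits under the quantifiers so that a patch can be chosen for
    every \<open>p\<close> at once.\<close>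
  have "\<exists>U \<phi> T q. p \<in> topspace (mtop M) \<longrightarrow> (U, \<phi>) \<in> charts M \<and> p \<in> U \<and> open T \<and> \<phi> p \<in> T \<and>
    (\<forall>k. Ck_on k q T) \<and> (\<forall>x\<in>T. q x > (0::real)) \<and> (\<forall>y\<in>U. \<phi> y \<in> T \<longrightarrow> f y = q (\<phi> y) * f' y)" for p
    using bdf_ratio_local[OF M f f', of p] by blast
  then obtain U \<phi> T q where local: "\<And>p. p \<in> topspace (mtop M) \<Longrightarrow> (U p, \<phi> p) \<in> charts M \<and> p \<in> U p \<and>
      open (T p) \<and> \<phi> p p \<in> T p \<and> (\<forall>k. Ck_on k (q p) (T p)) \<and> (\<forall>x\<in>T p. q p x > (0::real)) \<and>
      (\<forall>y\<in>U p. \<phi> p y \<in> T p \<longrightarrow> f y = q p (\<phi> p y) * f' y)"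
    by metis
  \<comment> \<open>Each patch is evaluated at its own centre. The expression
    \<open>f p / f' p\<close> would give 0 on the boundary and lose positivity there.\<close>
  define r where "r p = q p (\<phi> p p)" for p
  have r_eq: "q p (\<phi> p x) = r x" if p: "p \<in> topspace (mtop M)" and x: "x \<in> U p" "\<phi> p x \<in> T p" for p x
  proof -
    note lp = local[OF p]
    have "x \<in> topspace (mtop M)" using chart_subset[OF M] lp x(1) by blast
    note lx = local[OF this]
    let ?W = "{y \<in> U p. \<phi> p y \<in> T p} \<inter> {y \<in> U x. \<phi> x y \<in> T x}"
    have "q p (\<phi> p x) = q x (\<phi> x x)"
    proof (rule continuous_eq_off_mboundary[OF M f', of ?W "\<lambda>y. q p (\<phi> p y)" "\<lambda>y. q x (\<phi> x y)"])
      show "openin (mtop M) ?W"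
        using lp lx by (intro openin_Int chart_openin_vimage[OF M]) blast+
      show "continuous_map (subtopology (mtop M) ?W) euclidean (\<lambda>y. q p (\<phi> p y))"
        by (rule chart_compose_continuous[OF M, of "U p" "\<phi> p" "T p"])
          (use lp Ck_on_imp_continuous_on[of 0 "q p" "T p"] in auto)
      show "continuous_map (subtopology (mtop M) ?W) euclidean (\<lambda>y. q x (\<phi> x y))"
        by (rule chart_compose_continuous[OF M, of "U x" "\<phi> x" "T x"])
          (use lx Ck_on_imp_continuous_on[of 0 "q x" "T x"] in auto)
      show "x \<in> ?W" using lx x by blast
      show "q p (\<phi> p y) = q x (\<phi> x y)" if y: "y \<in> ?W" "y \<notin> mboundary M" for y
      proof -
        have "y \<in> topspace (mtop M)" using chart_subset[OF M] lp y(1) by blast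
        then have "f' y \<noteq> 0" using bdf_zero_iff[OF f'] y(2) by blast
        moreover have "q p (\<phi> p y) * f' y = q x (\<phi> x y) * f' y" using lp lx y(1) by auto
        ultimately show ?thesis by simp
      qed
    qed
    then show ?thesis by (simp add: r_def)
  qed
  show thesis
  proof
    show "smooth_real_function M r"
    proof (rule smooth_map_vector_spaceI[OF M])
      fix p assume p: "p \<in> topspace (mtop M)"
      show "\<exists>U \<phi> T q. (U, \<phi>) \<in> charts M \<and> p \<in> U \<and> open T \<and> \<phi> p \<in> T \<and> (\<forall>k. Ck_on k q T) \<and>
          (\<forall>x\<in>U. \<phi> x \<in> T \<longrightarrow> r x = q (\<phi> x))"
        by (intro exI[of _ "U p"] exI[of _ "\<phi> p"] exI[of _ "T p"] exI[of _ "q p"] conjI ballI impI)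
          (use local[OF p] r_eq[OF p] in simp_all)
    qed
    show "r x > 0" "f x = r x * f' x" if "x \<in> topspace (mtop M)" for x
      using local[OF that] by (simp_all add: r_def)
  qed
qed

section \<open>The circle action and invariant neighbourhoods\<close>

lemma
  assumes "a \<in> S1"
  shows S1_nonzero: "a \<noteq> 0" and S1_inverse: "inverse a \<in> S1"
    and S1_mult: "b \<in> S1 \<Longrightarrow> a * b \<in> S1"
  using assms by (auto simp: S1_def norm_mult norm_inverse)

lemma S1_one: "1 \<in> S1"
  by (simp add: S1_def)

lemma
  assumes "free_circle_action_near_boundary M"
  shows circle_action_is_bmanifold: "is_bmanifold M"
    and act_dom_openin: "openin (mtop M) (act_dom M)"
    and mboundary_subset_act_dom: "mboundary M \<subseteq> act_dom M"
    and act_in_dom: "a \<in> S1 \<Longrightarrow> x \<in> act_dom M \<Longrightarrow> act M a x \<in> act_dom M"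
    and act_one: "x \<in> act_dom M \<Longrightarrow> act M 1 x = x"
    and act_mult: "a \<in> S1 \<Longrightarrow> b \<in> S1 \<Longrightarrow> x \<in> act_dom M \<Longrightarrow> act M (a * b) x = act M a (act M b x)"
    and act_smooth: "smooth_map (prod_manifold circle_manifold (open_submanifold M (act_dom M)))
       (open_submanifold M (act_dom M)) (\<lambda>(a, x). act M a x)"
  using assms unfolding free_circle_action_near_boundary_def by simp_all

lemma act_inverse:
  assumes M: "free_circle_action_near_boundary M" and "a \<in> S1" "x \<in> act_dom M"
  shows "act M (inverse a) (act M a x) = x" "act M a (act M (inverse a) x) = x"
  using act_mult[OF M S1_inverse[OF assms(2)] assms(2,3)] act_mult[OF M assms(2) S1_inverse[OF assms(2)] assms(3)]
    act_one[OF M assms(3)] S1_nonzero[OF assms(2)] by simp_all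

lemma act_continuous:
  assumes M: "free_circle_action_near_boundary M" and a: "a \<in> S1"
  shows "continuous_map (subtopology (mtop M) (act_dom M)) (mtop M) (act M a)"
proof -
  let ?X = "subtopology (mtop M) (act_dom M)"
  have 1: "continuous_map (prod_topology (top_of_set S1) ?X) ?X (\<lambda>(a, x). act M a x)"
    using smooth_map_continuous[OF act_smooth[OF M]]
    by (simp add: mtop_prod_manifold mtop_open_submanifold circle_manifold_def)
  have 2: "continuous_map ?X (prod_topology (top_of_set S1) ?X) (\<lambda>x. (a, x))"
    using a by (intro continuous_map_pairedI) simp_all
  from continuous_map_compose[OF 2 1] have "continuous_map ?X ?X (act M a)"
    by (simp add: o_def)
  then show ?thesis by (simp add: continuous_map_in_subtopology)
qed

lemma invariant_boundary_nbhdE: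
  assumes "invariant_boundary_nbhd M V"
  obtains W where "V \<subseteq> act_dom M" "openin (mtop M) W" "mboundary M \<subseteq> W" "W \<subseteq> V"
    "\<And>a x. a \<in> S1 \<Longrightarrow> x \<in> V \<Longrightarrow> act M a x \<in> V"
  using assms unfolding invariant_boundary_nbhd_def by blast

lemma invariant_boundary_nbhd_Int:
  assumes "invariant_boundary_nbhd M V" "invariant_boundary_nbhd M V'"
  shows "invariant_boundary_nbhd M (V \<inter> V')"
proof -
  obtain W where W: "V \<subseteq> act_dom M" "openin (mtop M) W" "mboundary M \<subseteq> W" "W \<subseteq> V"
    "\<And>a x. a \<in> S1 \<Longrightarrow> x \<in> V \<Longrightarrow> act M a x \<in> V"
    by (rule invariant_boundary_nbhdE[OF assms(1)]) blast
  obtain W' where W': "V' \<subseteq> act_dom M" "openin (mtop M) W'" "mboundary M \<subseteq> W'" "W' \<subseteq> V'"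
    "\<And>a x. a \<in> S1 \<Longrightarrow> x \<in> V' \<Longrightarrow> act M a x \<in> V'"
    by (rule invariant_boundary_nbhdE[OF assms(2)]) blast
  show ?thesis
    unfolding invariant_boundary_nbhd_def using W W'
    by (intro conjI exI[of _ "W \<inter> W'"]) (auto intro: openin_Int)
qed

text \<open>The open set is the saturation of the given open neighbourhood under the action.\<close>

lemma open_invariant_boundary_nbhd:
  assumes M: "free_circle_action_near_boundary M" and V: "invariant_boundary_nbhd M V"
  obtains W where "openin (mtop M) W" "invariant_boundary_nbhd M W" "W \<subseteq> V"
proof -
  obtain O' where O': "V \<subseteq> act_dom M" "openin (mtop M) O'" "mboundary M \<subseteq> O'" "O' \<subseteq> V"
    and inv: "\<And>a x. a \<in> S1 \<Longrightarrow> x \<in> V \<Longrightarrow> act M a x \<in> V"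
    by (rule invariant_boundary_nbhdE[OF V]) blast
  define W where "W = (\<Union>a\<in>S1. act M a ` O')"
  have "openin (mtop M) (act M a ` O')" if a: "a \<in> S1" for a
  proof -
    have "openin (mtop M) {x \<in> topspace (subtopology (mtop M) (act_dom M)). act M (inverse a) x \<in> O'}"
      by (rule openin_trans_full[OF openin_continuous_map_preimage[OF
            act_continuous[OF M S1_inverse[OF a]] O'(2)] act_dom_openin[OF M]])
    \<comment> \<open>The translate by \<open>a\<close> is the preimage under the action of
      \<open>inverse a\<close>, hence open by continuity.\<close>
    also have "{x \<in> topspace (subtopology (mtop M) (act_dom M)). act M (inverse a) x \<in> O'} = act M a ` O'"
    proof (intro equalityI subsetI)
      fix x assume "x \<in> {x \<in> topspace (subtopology (mtop M) (act_dom M)). act M (inverse a) x \<in> O'}"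
      then have "act M (inverse a) x \<in> O'" "act M a (act M (inverse a) x) = x"
        using act_inverse(2)[OF M a] by simp_all
      then show "x \<in> act M a ` O'" by (metis imageI)
    next
      fix x assume "x \<in> act M a ` O'"
      then obtain y where y: "y \<in> O'" "x = act M a y" by blast
      then have "y \<in> act_dom M" using O' by blast
      then show "x \<in> {x \<in> topspace (subtopology (mtop M) (act_dom M)). act M (inverse a) x \<in> O'}"
        using y act_inverse(1)[OF M a] act_in_dom[OF M a] openin_subset[OF act_dom_openin[OF M]] by auto
    qed
    finally show ?thesis .
  qed
  then have "openin (mtop M) W" unfolding W_def by (intro openin_Union) blast
  moreover have WV: "W \<subseteq> V" using inv O'(4) by (auto simp: W_def)
  moreover have "mboundary M \<subseteq> W"
  proof
    fix x assume x: "x \<in> mboundary M"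
    then have "x = act M 1 x" "x \<in> O'" using act_one[OF M] mboundary_subset_act_dom[OF M] O'(3) by auto
    then show "x \<in> W" unfolding W_def using S1_one by blast
  qed
  moreover have "act M a x \<in> W" if a: "a \<in> S1" and x: "x \<in> W" for a x
  proof -
    obtain b y where y: "b \<in> S1" "y \<in> O'" "x = act M b y" using x by (auto simp: W_def)
    then have "y \<in> act_dom M" using O' by blast
    then have "act M a x = act M (a * b) y" using act_mult[OF M a y(1)] y(3) by simp
    then show ?thesis using S1_mult[OF a y(1)] y(2) by (auto simp: W_def)
  qed
  ultimately have "openin (mtop M) W" "invariant_boundary_nbhd M W" "W \<subseteq> V"
    using O'(1) unfolding invariant_boundary_nbhd_def by auto
  then show thesis by (rule that)
qed

section \<open>Transverse maps and the cut space\<close>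

lemma cut_relI:
  assumes "x \<in> topspace (mtop M)" "y \<in> topspace (mtop M)"
    and "x = y \<or> x \<in> mboundary M \<and> y \<in> mboundary M \<and> (\<exists>a\<in>S1. y = act M a x)"
  shows "(x, y) \<in> cut_rel M"
  using assms by (simp add: cut_rel_def)

lemma cut_rel_sym:
  assumes M: "free_circle_action_near_boundary M" and "(x, y) \<in> cut_rel M"
  shows "(y, x) \<in> cut_rel M"
proof (cases "x = y")
  case True
  with assms(2) show ?thesis by simp
next
  case False
  with assms(2) obtain a where a: "a \<in> S1" "y = act M a x" and
    xy: "x \<in> topspace (mtop M)" "y \<in> topspace (mtop M)" "x \<in> mboundary M" "y \<in> mboundary M"
    by (auto simp: cut_rel_def)
  have "x = act M (inverse a) y"
    using act_inverse(1)[OF M a(1)] mboundary_subset_act_dom[OF M] xy(3) a(2) by auto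
  with xy S1_inverse[OF a(1)] show ?thesis by (intro cut_relI) auto
qed

lemma cut_rel_trans:
  assumes M: "free_circle_action_near_boundary M" and "(x, y) \<in> cut_rel M" "(y, z) \<in> cut_rel M"
  shows "(x, z) \<in> cut_rel M"
proof (cases "x = y \<or> y = z")
  case True
  with assms(2,3) show ?thesis by auto
next
  case False
  with assms(2,3) obtain a b where a: "a \<in> S1" "y = act M a x" and b: "b \<in> S1" "z = act M b y" and
    xy: "x \<in> topspace (mtop M)" "z \<in> topspace (mtop M)" "x \<in> mboundary M" "z \<in> mboundary M"
    by (auto simp: cut_rel_def)
  have "z = act M (b * a) x"
    using act_mult[OF M b(1) a(1)] mboundary_subset_act_dom[OF M] xy(3) a(2) b(2) by auto
  with xy S1_mult[OF b(1) a(1)] show ?thesis by (intro cut_relI) auto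
qed

lemma cut_proj_eqI:
  assumes M: "free_circle_action_near_boundary M" and "(x, y) \<in> cut_rel M"
  shows "cut_proj M x = cut_proj M y"
  using assms cut_rel_sym[OF M] cut_rel_trans[OF M] unfolding cut_proj_def by blast

lemma cut_proj_eqD:
  assumes "cut_proj M x = cut_proj M y" "y \<in> topspace (mtop M)"
  shows "(x, y) \<in> cut_rel M"
proof -
  have "y \<in> cut_proj M y" using assms(2) by (simp add: cut_proj_def cut_rel_def)
  then show ?thesis using assms(1) by (auto simp: cut_proj_def)
qed

lemma topspace_cut_space_eq_image: "topspace (cut_space M) = cut_proj M ` topspace (mtop M)"
  by (auto simp: topspace_cut_space quotient_def cut_proj_def)

lemma
  assumes "equivariant_transverse_map M N \<psi>"
  shows transverse_smooth: "smooth_map M N \<psi>"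
    and transverse_bdf: "\<exists>f. invariant_boundary_defining_function N f \<and>
          invariant_boundary_defining_function M (f \<circ> \<psi>)"
    and transverse_equivariant: "\<exists>V. invariant_boundary_nbhd M V \<and> V \<subseteq> \<psi> -` act_dom N \<and>
          (\<forall>a\<in>S1. \<forall>x\<in>V. \<psi> (act M a x) = act N a (\<psi> x))"
  using assms unfolding equivariant_transverse_map_def by blast+

lemma transverse_topspace:
  assumes "equivariant_transverse_map M N \<psi>" "x \<in> topspace (mtop M)"
  shows "\<psi> x \<in> topspace (mtop N)"
  using smooth_map_continuous[OF transverse_smooth[OF assms(1)]] assms(2)
  by (auto simp: continuous_map_def)

text \<open>For a suitable \<open>f\<close>, the zero sets of \<open>f\<close> and of
  \<open>f \<circ> \<psi>\<close> are the two boundaries.\<close>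

lemma transverse_mboundary_iff:
  assumes \<psi>: "equivariant_transverse_map M N \<psi>" and x: "x \<in> topspace (mtop M)"
  shows "\<psi> x \<in> mboundary N \<longleftrightarrow> x \<in> mboundary M"
proof -
  obtain f where f: "invariant_boundary_defining_function N f"
    "invariant_boundary_defining_function M (f \<circ> \<psi>)" using transverse_bdf[OF \<psi>] by blast
  show ?thesis
    using bdf_zero_iff[OF f(1) transverse_topspace[OF \<psi> x]] bdf_zero_iff[OF f(2) x] by simp
qed

text \<open>Discharges the definite description in \<open>cut_map\<close>. Existence holds because
  \<open>\<psi>\<close> respects the equivalence relations; uniqueness because
  \<open>cut_proj M\<close> is onto and the maps considered are extensional.\<close>

lemma cut_map_cut_proj:
  assumes M: "free_circle_action_near_boundary M" and N: "free_circle_action_near_boundary N"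
    and \<psi>: "equivariant_transverse_map M N \<psi>" and x: "x \<in> topspace (mtop M)"
  shows "cut_map M N \<psi> (cut_proj M x) = cut_proj N (\<psi> x)"
proof -
  obtain V where V: "invariant_boundary_nbhd M V"
    and eqv: "\<And>a x. a \<in> S1 \<Longrightarrow> x \<in> V \<Longrightarrow> \<psi> (act M a x) = act N a (\<psi> x)"
    using transverse_equivariant[OF \<psi>] by blast
  have "mboundary M \<subseteq> V" using V by (rule invariant_boundary_nbhdE) blast
  \<comment> \<open>Distinct equivalent points lie on the boundary, hence in \<open>V\<close>, where
    \<open>\<psi>\<close> is equivariant; their images are again boundary points in one
    orbit.\<close>
  have compat: "cut_proj N (\<psi> y) = cut_proj N (\<psi> z)"
    if y: "y \<in> topspace (mtop M)" and z: "z \<in> topspace (mtop M)" and eq: "cut_proj M y = cut_proj M z" for y z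
  proof (rule cut_proj_eqI[OF N])
    have "y = z \<or> y \<in> mboundary M \<and> z \<in> mboundary M \<and> (\<exists>a\<in>S1. z = act M a y)"
      using cut_proj_eqD[OF eq z] by (auto simp: cut_rel_def)
    then have "\<psi> y = \<psi> z \<or> \<psi> y \<in> mboundary N \<and> \<psi> z \<in> mboundary N \<and> (\<exists>a\<in>S1. \<psi> z = act N a (\<psi> y))"
      using eqv \<open>mboundary M \<subseteq> V\<close> transverse_mboundary_iff[OF \<psi>] y z by blast
    then show "(\<psi> y, \<psi> z) \<in> cut_rel N"
      using transverse_topspace[OF \<psi>] y z by (intro cut_relI)
  qed
  let ?P = "\<lambda>g. g \<in> topspace (cut_space M) \<rightarrow>\<^sub>E topspace (cut_space N) \<and>
    (\<forall>x\<in>topspace (mtop M). g (cut_proj M x) = cut_proj N (\<psi> x))"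
  define g where "g = (\<lambda>c\<in>topspace (cut_space M).
    cut_proj N (\<psi> (SOME x. x \<in> topspace (mtop M) \<and> cut_proj M x = c)))"
  have g_eq: "g (cut_proj M y) = cut_proj N (\<psi> y)" if y: "y \<in> topspace (mtop M)" for y
  proof -
    let ?z = "SOME x. x \<in> topspace (mtop M) \<and> cut_proj M x = cut_proj M y"
    have "?z \<in> topspace (mtop M) \<and> cut_proj M ?z = cut_proj M y"
      by (rule someI[of _ y]) (simp add: y)
    then have "cut_proj N (\<psi> ?z) = cut_proj N (\<psi> y)" using compat y by blast
    then show ?thesis using y by (simp add: g_def topspace_cut_space_eq_image)
  qed
  have "?P g"
  proof (intro conjI ballI g_eq)
    show "g \<in> topspace (cut_space M) \<rightarrow>\<^sub>E topspace (cut_space N)"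
    proof (rule PiE_I)
      show "g c \<in> topspace (cut_space N)" if "c \<in> topspace (cut_space M)" for c
      proof -
        obtain y where "y \<in> topspace (mtop M)" "c = cut_proj M y"
          using \<open>c \<in> topspace (cut_space M)\<close> unfolding topspace_cut_space_eq_image by blast
        then show ?thesis
          using g_eq transverse_topspace[OF \<psi>] by (simp add: topspace_cut_space_eq_image)
      qed
    qed (simp add: g_def)
  qed
  moreover have "g' = g" if "?P g'" for g'
  proof (rule PiE_ext)
    show "g' \<in> topspace (cut_space M) \<rightarrow>\<^sub>E topspace (cut_space N)"
      "g \<in> topspace (cut_space M) \<rightarrow>\<^sub>E topspace (cut_space N)" using that \<open>?P g\<close> by blast+
    show "g' c = g c" if "c \<in> topspace (cut_space M)" for c
      using \<open>?P g'\<close> g_eq that unfolding topspace_cut_space_eq_image by auto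
  qed
  ultimately have "cut_map M N \<psi> = g"
    unfolding cut_map_def by (rule the_equality)
  then show ?thesis using g_eq[OF x] by simp
qed

text \<open>The preimage surrounds the boundary of \<open>M\<close> because \<open>\<psi>\<close>
  maps boundary to boundary, and equivariance on \<open>V\<close> makes it invariant.\<close>

lemma invariant_boundary_nbhd_vimage:
  assumes \<psi>: "equivariant_transverse_map M N \<psi>" and V: "invariant_boundary_nbhd M V"
    and eqv: "\<And>a x. a \<in> S1 \<Longrightarrow> x \<in> V \<Longrightarrow> \<psi> (act M a x) = act N a (\<psi> x)"
    and V': "invariant_boundary_nbhd N V'"
  shows "invariant_boundary_nbhd M (V \<inter> \<psi> -` V')"
proof -
  obtain W where W: "V \<subseteq> act_dom M" "openin (mtop M) W" "mboundary M \<subseteq> W" "W \<subseteq> V"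
    "\<And>a x. a \<in> S1 \<Longrightarrow> x \<in> V \<Longrightarrow> act M a x \<in> V"
    by (rule invariant_boundary_nbhdE[OF V]) blast
  obtain W' where W': "V' \<subseteq> act_dom N" "openin (mtop N) W'" "mboundary N \<subseteq> W'" "W' \<subseteq> V'"
    "\<And>a x. a \<in> S1 \<Longrightarrow> x \<in> V' \<Longrightarrow> act N a x \<in> V'"
    by (rule invariant_boundary_nbhdE[OF V']) blast
  let ?W = "W \<inter> {x \<in> topspace (mtop M). \<psi> x \<in> W'}"
  have "openin (mtop M) ?W"
    using W(2) openin_continuous_map_preimage[OF smooth_map_continuous[OF transverse_smooth[OF \<psi>]] W'(2)]
    by (rule openin_Int)
  moreover have "mboundary M \<subseteq> ?W"
  proof
    fix x assume x: "x \<in> mboundary M"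
    then have xW: "x \<in> W" "x \<in> topspace (mtop M)" using W(2,3) openin_subset by blast+
    with transverse_mboundary_iff[OF \<psi> xW(2)] x W'(3) show "x \<in> ?W" by auto
  qed
  moreover have "?W \<subseteq> V \<inter> \<psi> -` V'" using W(4) W'(4) by blast
  moreover have "act M a x \<in> V \<inter> \<psi> -` V'" if "a \<in> S1" "x \<in> V \<inter> \<psi> -` V'" for a x
    using that W(5) W'(5) eqv by simp
  ultimately show ?thesis
    unfolding invariant_boundary_nbhd_def using W(1) by blast
qed

lemma finite_span_complex: "finite (Basis :: complex set)" "span (Basis :: complex set) = UNIV"
  by simp_all

text \<open>\<open>compose\<close> restricts the composite to \<open>topspace (cut_space M)\<close>,
  since members of \<open>cut_functions\<close> are extensional. Both \<open>f\<^sub>M\<close> and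
  \<open>f\<^sub>N\<close> are arbitrary, so independence of the function sets from these choices is
  not presupposed.\<close>

theorem lemma2p7:
  fixes M :: "('a, 'e::real_inner) circle_bmanifold"
    and N :: "('b, 'f::real_inner) circle_bmanifold"
    and f\<^sub>M :: "'a \<Rightarrow> real" and f\<^sub>N :: "'b \<Rightarrow> real"
    and \<psi> :: "'a \<Rightarrow> 'b" and h\<^sub>N :: "'b set \<Rightarrow> real"
  assumes "free_circle_action_near_boundary M"
    and "free_circle_action_near_boundary N"
    and "invariant_boundary_defining_function M f\<^sub>M"
    and "invariant_boundary_defining_function N f\<^sub>N"
    and "equivariant_transverse_map M N \<psi>"
    and "h\<^sub>N \<in> cut_functions N f\<^sub>N"
  shows "compose (topspace (cut_space M)) h\<^sub>N (cut_map M N \<psi>) \<in> cut_functions M f\<^sub>M"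
proof -
  note M = assms(1) and N = assms(2) and fM = assms(3) and fN = assms(4) and \<psi> = assms(5)
  note aM = is_bmanifold_imp_smooth_atlas[OF circle_action_is_bmanifold[OF M]]
    and aN = is_bmanifold_imp_smooth_atlas[OF circle_action_is_bmanifold[OF N]]
  define h where "h = compose (topspace (cut_space M)) h\<^sub>N (cut_map M N \<psi>)"
  have h: "(h \<circ> cut_proj M) x = (h\<^sub>N \<circ> cut_proj N) (\<psi> x)" if "x \<in> topspace (mtop M)" for x
    using that cut_map_cut_proj[OF M N \<psi> that]
    by (simp add: h_def compose_def topspace_cut_space_eq_image)
  let ?C = "vector_space_manifold :: (complex, complex) bmanifold"
  obtain V\<^sub>N H\<^sub>N where VN: "invariant_boundary_nbhd N V\<^sub>N"
    and HN: "smooth_real_function (prod_manifold (open_submanifold N V\<^sub>N) ?C) H\<^sub>N"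
      "\<And>a x z. a \<in> S1 \<Longrightarrow> x \<in> V\<^sub>N \<Longrightarrow> H\<^sub>N (act N a x, z) = H\<^sub>N (x, a * z)"
      "\<And>x. x \<in> V\<^sub>N \<Longrightarrow> (h\<^sub>N \<circ> cut_proj N) x = H\<^sub>N (x, complex_of_real (sqrt (f\<^sub>N x)))"
    and hN_int: "smooth_real_function (open_submanifold N (minterior N)) (h\<^sub>N \<circ> cut_proj N)"
    using assms(6) unfolding cut_functions_def by blast

  \<comment> \<open>\<open>\<psi>\<close> maps interior to interior, so smoothness of
    \<open>h\<^sub>N\<close> on the interior of \<open>N\<close> is pulled back by
    composition.\<close>
  have interior: "smooth_real_function (open_submanifold M (minterior M)) (h \<circ> cut_proj M)"
  proof (rule smooth_map_cong)
    show atl: "smooth_atlas (open_submanifold M (minterior M))"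
      by (rule smooth_atlas_open_submanifold[OF aM])
    have "smooth_map (open_submanifold M (minterior M)) (open_submanifold N (minterior N)) \<psi>"
      by (rule smooth_map_open_submanifold_target[OF
            smooth_map_open_submanifold_source[OF aM transverse_smooth[OF \<psi>]]])
        (auto simp: mtop_open_submanifold minterior_def transverse_topspace[OF \<psi>]
          transverse_mboundary_iff[OF \<psi>])
    then show "smooth_real_function (open_submanifold M (minterior M)) (\<lambda>x. (h\<^sub>N \<circ> cut_proj N) (\<psi> x))"
      by (rule smooth_map_compose[OF atl smooth_atlas_open_submanifold[OF aN] _ hN_int])
    show "(h\<^sub>N \<circ> cut_proj N) (\<psi> x) = (h \<circ> cut_proj M) x"
      if "x \<in> topspace (mtop (open_submanifold M (minterior M)))" for x
      using h[of x] that by (simp add: mtop_open_submanifold)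
  qed

  obtain f where f: "invariant_boundary_defining_function N f"
    "invariant_boundary_defining_function M (f \<circ> \<psi>)" using transverse_bdf[OF \<psi>] by blast
  obtain r where r: "smooth_real_function N r" "\<And>y. y \<in> topspace (mtop N) \<Longrightarrow> r y > 0"
    "\<And>y. y \<in> topspace (mtop N) \<Longrightarrow> f\<^sub>N y = r y * f y"
    by (rule bdf_ratio[OF aN fN f(1)]) blast
  obtain s where s: "smooth_real_function M s" "\<And>x. x \<in> topspace (mtop M) \<Longrightarrow> s x > 0"
    "\<And>x. x \<in> topspace (mtop M) \<Longrightarrow> (f \<circ> \<psi>) x = s x * f\<^sub>M x"
    by (rule bdf_ratio[OF aM f(2) fM]) blast
  define g where "g x = r (\<psi> x) * s x" for x
  have g_smooth: "smooth_real_function M g"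
    unfolding g_def
    by (rule smooth_map_bilinear[OF aM smooth_map_compose[OF aM aN transverse_smooth[OF \<psi>] r(1)] s(1)
          bounded_bilinear_mult])
  have g_pos: "g x > 0" if "x \<in> topspace (mtop M)" for x
    using r(2)[OF transverse_topspace[OF \<psi> that]] s(2)[OF that] by (simp add: g_def)
  have g_eq: "f\<^sub>N (\<psi> x) = g x * f\<^sub>M x" if "x \<in> topspace (mtop M)" for x
    using r(3)[OF transverse_topspace[OF \<psi> that]] s(3)[OF that] by (simp add: g_def)

  obtain V\<^sub>0 where V0: "invariant_boundary_nbhd M V\<^sub>0"
    and eqv: "\<And>a x. a \<in> S1 \<Longrightarrow> x \<in> V\<^sub>0 \<Longrightarrow> \<psi> (act M a x) = act N a (\<psi> x)"
    using transverse_equivariant[OF \<psi>] by blast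
  obtain V\<^sub>1 where V1: "invariant_boundary_nbhd M V\<^sub>1"
    "\<And>a x. a \<in> S1 \<Longrightarrow> x \<in> V\<^sub>1 \<Longrightarrow> f\<^sub>M (act M a x) = f\<^sub>M x"
    using fM unfolding invariant_boundary_defining_function_def by blast
  obtain V\<^sub>2 where V2: "invariant_boundary_nbhd N V\<^sub>2"
    "\<And>a y. a \<in> S1 \<Longrightarrow> y \<in> V\<^sub>2 \<Longrightarrow> f\<^sub>N (act N a y) = f\<^sub>N y"
    using fN unfolding invariant_boundary_defining_function_def by blast
  \<comment> \<open>\<open>V\<^sub>0\<close> gives equivariance of \<open>\<psi>\<close>,
    \<open>V\<^sub>N\<close> the domain of \<open>H\<^sub>N\<close>, \<open>V\<^sub>1\<close> and
    \<open>V\<^sub>2\<close> invariance of \<open>f\<^sub>M\<close> and \<open>f\<^sub>N\<close>. An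
    open invariant neighbourhood inside is then extracted, as \<open>cut_functions\<close>
    demands.\<close>
  have "invariant_boundary_nbhd M ((V\<^sub>0 \<inter> \<psi> -` (V\<^sub>N \<inter> V\<^sub>2)) \<inter> V\<^sub>1)"
    by (intro invariant_boundary_nbhd_Int[OF invariant_boundary_nbhd_vimage[OF \<psi> V0 eqv
            invariant_boundary_nbhd_Int[OF VN V2(1)]] V1(1)])
  then obtain V where V: "openin (mtop M) V" "invariant_boundary_nbhd M V"
    "V \<subseteq> (V\<^sub>0 \<inter> \<psi> -` (V\<^sub>N \<inter> V\<^sub>2)) \<inter> V\<^sub>1"
    by (rule open_invariant_boundary_nbhd[OF M])
  have V_top: "V \<subseteq> topspace (mtop M)" using V(1) by (rule openin_subset)
  have V_sub: "x \<in> V\<^sub>0" "\<psi> x \<in> V\<^sub>N" "\<psi> x \<in> V\<^sub>2" "x \<in> V\<^sub>1" if "x \<in> V" for x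
    using V(3) that by blast+
  have V_dom: "V \<subseteq> act_dom M" and V_inv: "\<And>a x. a \<in> S1 \<Longrightarrow> x \<in> V \<Longrightarrow> act M a x \<in> V"
    using V(2) unfolding invariant_boundary_nbhd_def by blast+

  have g_inv: "g (act M a x) = g x" if a: "a \<in> S1" and x: "x \<in> V" for a x
  proof (rule continuous_eq_off_mboundary[OF aM fM V(1) _ _ _ x])
    have g_cont: "continuous_map (mtop M) euclidean g"
      using smooth_map_continuous[OF g_smooth] by (simp add: vector_space_manifold_def)
    then show "continuous_map (subtopology (mtop M) V) euclidean g"
      by (rule continuous_map_from_subtopology)
    have "continuous_map (subtopology (mtop M) V) (mtop M) (act M a)"
      by (rule continuous_map_from_subtopology_mono[OF act_continuous[OF M a] V_dom])
    from continuous_map_compose[OF this g_cont]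
    show "continuous_map (subtopology (mtop M) V) euclidean (\<lambda>x. g (act M a x))"
      by (simp add: o_def)
    \<comment> \<open>Both sides, multiplied by \<open>f\<^sub>M y\<close>, equal
      \<open>f\<^sub>N (\<psi> y)\<close>; off the boundary this factor is nonzero and
      cancels.\<close>
    show "g (act M a y) = g y" if y: "y \<in> V" "y \<notin> mboundary M" for y
    proof -
      have ay: "act M a y \<in> V" using V_inv[OF a y(1)] .
      have "g (act M a y) * f\<^sub>M (act M a y) = f\<^sub>N (\<psi> (act M a y))"
        using g_eq V_top ay by auto
      also have "\<dots> = f\<^sub>N (\<psi> y)" using eqv[OF a V_sub(1)[OF y(1)]] V2(2)[OF a V_sub(3)[OF y(1)]] by simp
      also have "\<dots> = g y * f\<^sub>M y" using g_eq V_top y(1) by auto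
      finally have "g (act M a y) * f\<^sub>M y = g y * f\<^sub>M y" using V1(2)[OF a V_sub(4)[OF y(1)]] by simp
      moreover have "f\<^sub>M y \<noteq> 0" using bdf_zero_iff[OF fM] V_top y by blast
      ultimately show ?thesis by simp
    qed
  qed

  \<comment> \<open>The square root of \<open>g\<close>, written as a power so that
    \<open>smooth_map_powr\<close> applies; positivity of \<open>g\<close> on all of
    \<open>M\<close> is what makes it smooth.\<close>
  define k where "k x = g x powr (1 / 2)" for x
  have k_smooth: "smooth_real_function M k"
    unfolding k_def by (rule smooth_map_powr[OF aM g_smooth g_pos])
  define H where "H = (\<lambda>p. H\<^sub>N (\<psi> (fst p), k (fst p) *\<^sub>R snd p))"
  let ?MV = "open_submanifold M V" and ?NV = "open_submanifold N V\<^sub>N"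
  let ?P = "prod_manifold ?MV ?C"
  have aC: "smooth_atlas ?C" by (rule smooth_atlas_vector_space[OF finite_span_complex])
  have aMV: "smooth_atlas ?MV" by (rule smooth_atlas_open_submanifold[OF aM])
  have aNV: "smooth_atlas ?NV" by (rule smooth_atlas_open_submanifold[OF aN])
  have aP: "smooth_atlas ?P" by (rule smooth_atlas_prod_manifold[OF aMV aC])
  have "smooth_map ?MV ?NV \<psi>"
    by (rule smooth_map_open_submanifold_target[OF
          smooth_map_open_submanifold_source[OF aM transverse_smooth[OF \<psi>]]])
      (auto simp: mtop_open_submanifold V_sub)
  then have 1: "smooth_map ?P ?NV (\<lambda>p. \<psi> (fst p))"
    by (rule smooth_map_compose[OF aP aMV smooth_map_fst[OF aMV aC]])
  have "smooth_real_function ?MV k" by (rule smooth_map_open_submanifold_source[OF aM k_smooth])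
  then have "smooth_real_function ?P (\<lambda>p. k (fst p))"
    by (rule smooth_map_compose[OF aP aMV smooth_map_fst[OF aMV aC]])
  then have 2: "smooth_map ?P ?C (\<lambda>p. k (fst p) *\<^sub>R snd p)"
    by (rule smooth_map_bilinear[OF aP _ smooth_map_snd[OF aMV aC] bounded_bilinear_scaleR])
  have "smooth_real_function ?P H"
    unfolding H_def
    by (rule smooth_map_compose[OF aP smooth_atlas_prod_manifold[OF aNV aC] smooth_map_Pair[OF 1 2] HN(1)])
  moreover have "H (act M a x, z) = H (x, a * z)" if "a \<in> S1" "x \<in> V" for a x z
  proof -
    have "H (act M a x, z) = H\<^sub>N (act N a (\<psi> x), k x *\<^sub>R z)"
      using eqv[OF that(1) V_sub(1)[OF that(2)]] g_inv[OF that] by (simp add: H_def k_def)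
    \<comment> \<open>Here \<open>a\<close> multiplies the scaled variable; since \<open>k x\<close>
      is real, it can be moved past \<open>a\<close> afterwards.\<close>
    also have "\<dots> = H\<^sub>N (\<psi> x, a * (k x *\<^sub>R z))"
      by (rule HN(2)[OF that(1) V_sub(2)[OF that(2)]])
    finally show ?thesis by (simp add: H_def)
  qed
  moreover have "(h \<circ> cut_proj M) x = H (x, complex_of_real (sqrt (f\<^sub>M x)))" if "x \<in> V" for x
  proof -
    have x: "x \<in> topspace (mtop M)" using V_top that by blast
    have "(h \<circ> cut_proj M) x = H\<^sub>N (\<psi> x, complex_of_real (sqrt (f\<^sub>N (\<psi> x))))"
      using h[OF x] HN(3)[OF V_sub(2)[OF that]] by simp
    also have "sqrt (f\<^sub>N (\<psi> x)) = k x * sqrt (f\<^sub>M x)"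
      using g_pos[OF x] by (simp add: g_eq[OF x] k_def real_sqrt_mult powr_half_sqrt)
    finally show ?thesis by (simp add: H_def scaleR_conv_of_real)
  qed
  moreover have "h \<in> extensional (topspace (cut_space M))"
    by (simp add: h_def compose_extensional)
  ultimately have "h \<in> cut_functions M f\<^sub>M"
    unfolding cut_functions_def using interior V(1,2) by blast
  then show ?thesis by (simp add: h_def)
qed

end
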